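(* Let $q$ be a complex number with $0<|q|<1$. Then the following five identities hold: \begin{align*} \sum_{i,j,k\ge 0}\frac{q^{\frac{1}{2}i^2+2j^2+k^2+ij+2jk+\frac{1}{2}i-2j+k}}{(q;q)_i(q;q)_j(q^2;q^2)_k} &=2\,\frac{(q^8;q^8)_\infty}{(q;q)_\infty},\\ \sum_{i,j,k\ge 0}\frac{q^{\frac{1}{2}i^2+2j^2+k^2+ij+2jk+\frac{1}{2}i}}{(q;q)_i(q;q)_j(q^2;q^2)_k} &=\frac{(-q;q)_\infty}{(q,q^4,q^7;q^8)_\infty},\\ \sum_{i,j,k\ge 0}\frac{q^{\frac{1}{2}i^2+2j^2+k^2+ij+2jk+\frac{1}{2}i+k}}{(q;q)_i(q;q)_j(q^2;q^2)_k} &=\frac{(q^4;q^4)^3_\infty}{(q;q)_\infty(q^2;q^2)_\infty(q^8;q^8)_\infty},\\ \sum_{i,j,k\ge 0}\frac{q^{\frac{1}{2}i^2+2j^2+k^2+ij+2jk+\frac{1}{2}i+2j+k}}{(q;q)_i(q;q)_j(q^2;q^2)_k} &=\frac{(q^8;q^8)_\infty}{(q;q)_\infty},\\ \sum_{i,j,k\ge 0}\frac{q^{\frac{1}{2}i^2+2j^2+k^2+ij+2jk+\frac{1}{2}i+2j+2k}}{(q;q)_i(q;q)_j(q^2;q^2)_k} &=\frac{(-q;q)_\infty}{(q^3,q^4,q^5;q^8)_\infty}. \end{align*}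
   Context: For $|q|<1$: $(a;q)_\infty=\prod_{m=0}^\infty(1-aq^m)$, $(a;q)_n=(a;q)_\infty/(aq^n;q)_\infty=\prod_{m=0}^{n-1}(1-aq^m)$ for integers $n\ge0$, and $(a_1,\dots,a_r;q)_\infty=(a_1;q)_\infty\cdots(a_r;q)_\infty$; the same notation is used with the base $q$ replaced by a power of $q$. All exponents of $q$ in the sums are integers. *)

theory Defs
  imports "HOL-Analysis.Analysis"
begin

definition qpoch_inf :: "complex \<Rightarrow> complex \<Rightarrow> complex" where
  "qpoch_inf a q = (\<Prod>m. 1 - a * q ^ m)"

definition qpoch :: "complex \<Rightarrow> complex \<Rightarrow> nat \<Rightarrow> complex" where
  "qpoch a q n = (\<Prod>m<n. 1 - a * q ^ m)"

definition qpoch_inf_list :: "complex list \<Rightarrow> complex \<Rightarrow> complex" where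
  "qpoch_inf_list as q = (\<Prod>a\<leftarrow>as. qpoch_inf a q)"

(* The linear form b j + c k is the only part of the exponent that varies.  The division by 2
   is exact, as i^2 + i is even. *)
definition qexponent :: "int \<Rightarrow> int \<Rightarrow> nat \<Rightarrow> nat \<Rightarrow> nat \<Rightarrow> int" where
  "qexponent b c i j k =
     (int i ^ 2 + int i) div 2 + 2 * int j ^ 2 + int k ^ 2 + int i * int j + 2 * int j * int k
       + b * int j + c * int k"

definition qsummand :: "complex \<Rightarrow> int \<Rightarrow> int \<Rightarrow> nat \<times> nat \<times> nat \<Rightarrow> complex" where
  "qsummand q b c = (\<lambda>(i, j, k).
     q powi qexponent b c i j k / (qpoch q q i * qpoch q q j * qpoch (q ^ 2) (q ^ 2) k))"

end

theory Submission
  imports Defs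
begin

text \<open>
  The quadratic form in the exponent is almost diagonal: for a fixed \<open>j\<close>, the variables \<open>i\<close> and \<open>k\<close>
  occur in two separate series of the shape \<open>\<Sum>n. p^(n(n-1)/2) z^n / (p;p)\<^sub>n\<close>, which Euler's identity
  (\<open>euler_has_sum\<close>) sums to \<open>(-z;p)\<^sub>\<infinity>\<close>. Thus (\<open>qsummand_has_sum\<close>) every triple series equals
  \<open>(-q;q)\<^sub>\<infinity>\<close> times
  \<open>\<Sum>j. q^(2j^2+bj) (-q^(2j+c+1);q^2)\<^sub>\<infinity> / (q^2;q^2)\<^sub>j\<close>.

  For \<open>c = 1\<close> the infinite product in the summand differs from \<open>(-q^2;q^2)\<^sub>\<infinity>\<close> by a finite product that
  completes the denominator to \<open>(q^4;q^4)\<^sub>j\<close>. Euler's identity with base \<open>q^4\<close> then sums the series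
  once more (\<open>qsummand_has_sum_lebesgue\<close>). This settles the three identities with \<open>c = 1\<close>.

  The cases \<open>b = c = 0\<close> and \<open>b = c = 2\<close> are the two Goellnitz-Gordon identities. They are the members
  \<open>s = 0\<close> and \<open>s = 1\<close> of a family of series \<open>\<phi>\<^sub>s\<close> that satisfies the recurrence
  \<open>\<phi>\<^sub>s = (1 + q^(2s+1)) \<phi>\<^sub>s\<^sub>+\<^sub>1 + q^(2s+2) \<phi>\<^sub>s\<^sub>+\<^sub>2\<close> (\<open>gg_recurrence\<close>). A solution of this recurrence is determined
  by its limit for \<open>s \<rightarrow> \<infinity>\<close> (\<open>recurrence_null_solution\<close>). A second solution with a proportional limit
  comes from two well-poised series, following Andrews' proof of his generalised Rogers-Ramanujan
  identities: they satisfy two first-order relations (\<open>alpha_sum_relation\<close>, \<open>beta_sum_relation\<close>), each proved by splitting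
  a series in two and shifting the index in one part. Hence the two solutions are proportional
  (\<open>alpha_sum_eq_gg_sum\<close>). For \<open>s = 0\<close> and \<open>s = 1\<close> the well-poised side degenerates to a theta series
  (\<open>gg_theta_0\<close>, \<open>gg_theta_1\<close>), which the Jacobi triple product (\<open>jacobi_triple_product\<close>) evaluates.
  The triple product in turn is the limit of a finite identity that is proved by induction.
\<close>

section \<open>Finite and infinite q-products\<close>

lemma qpoch_0 [simp]: "qpoch a p 0 = 1"
  by (simp add: qpoch_def)

lemma qpoch_Suc: "qpoch a p (Suc n) = qpoch a p n * (1 - a * p ^ n)"
  by (simp add: qpoch_def)

lemma qpoch_add: "qpoch a p (m + n) = qpoch a p m * qpoch (a * p ^ m) p n"
  by (induction n) (simp_all add: qpoch_Suc power_add mult_ac)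

lemma convergent_prod_qpoch:
  fixes a p :: complex
  assumes "norm p < 1"
  shows "convergent_prod (\<lambda>m. 1 - a * p ^ m)"
proof -
  have "summable (\<lambda>m. norm (1 - a * p ^ m - 1))"
    using assms by (auto simp: norm_mult norm_power intro!: summable_mult summable_geometric)
  then show ?thesis
    by (intro abs_convergent_prod_imp_convergent_prod summable_imp_abs_convergent_prod)
qed

lemma qpoch_tendsto:
  assumes "norm p < 1"
  shows "qpoch a p \<longlonglongrightarrow> qpoch_inf a p"
proof -
  have "(\<lambda>n. \<Prod>m\<le>n. 1 - a * p ^ m) \<longlonglongrightarrow> qpoch_inf a p"
    unfolding qpoch_inf_def using assms by (intro convergent_prod_LIMSEQ convergent_prod_qpoch)
  then have "(\<lambda>n. qpoch a p (Suc n)) \<longlonglongrightarrow> qpoch_inf a p"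
    by (simp add: qpoch_def lessThan_Suc_atMost)
  then show ?thesis
    by (rule LIMSEQ_imp_Suc)
qed

lemma one_minus_mult_power_neq_0:
  fixes a p :: complex
  assumes "norm a < 1" "norm p < 1"
  shows "1 - a * p ^ n \<noteq> 0"
proof
  assume "1 - a * p ^ n = 0"
  then have "norm (a * p ^ n) = 1" by simp
  moreover have "norm (a * p ^ n) \<le> norm a"
    using assms by (simp add: norm_mult norm_power mult_left_le power_le_one)
  ultimately show False using assms by simp
qed

lemma qpoch_neq_0: "norm a < 1 \<Longrightarrow> norm p < 1 \<Longrightarrow> qpoch a p n \<noteq> 0"
  by (induction n) (use one_minus_mult_power_neq_0 in \<open>auto simp: qpoch_Suc\<close>)

lemma qpoch_inf_neq_0:
  assumes "norm a < 1" "norm p < 1"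
  shows "qpoch_inf a p \<noteq> 0"
  unfolding qpoch_inf_def
  by (rule prodinf_nonzero) (use assms one_minus_mult_power_neq_0 convergent_prod_qpoch in auto)

text \<open>The bounds behind all exchanges of limits: the finite products converge to a non-zero limit,
  so they and their reciprocals are bounded.\<close>

lemma qpoch_bounds:
  assumes "norm a < 1" "norm p < 1"
  obtains K where "K > 0" "\<And>n. norm (qpoch a p n) \<le> K" "\<And>n. inverse (norm (qpoch a p n)) \<le> K"
proof -
  have "Bseq (qpoch a p)"
    using qpoch_tendsto[OF assms(2)] by (meson convergentI convergent_imp_Bseq)
  moreover have "Bseq (\<lambda>n. inverse (qpoch a p n))"
    using tendsto_inverse[OF qpoch_tendsto[OF assms(2)] qpoch_inf_neq_0[OF assms]]
    by (meson convergentI convergent_imp_Bseq)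
  ultimately obtain K1 K2 where "K1 > 0" "\<And>n. norm (qpoch a p n) \<le> K1"
      "K2 > 0" "\<And>n. norm (inverse (qpoch a p n)) \<le> K2"
    unfolding Bseq_def by blast
  then show ?thesis
    by (intro that[of "max K1 K2"]) (auto simp: norm_inverse le_max_iff_disj)
qed

lemma qpoch_inf_unfold:
  assumes "norm p < 1"
  shows "qpoch_inf a p = qpoch a p n * qpoch_inf (a * p ^ n) p"
proof -
  have "(\<lambda>m. qpoch a p (m + n)) \<longlonglongrightarrow> qpoch_inf a p"
    using qpoch_tendsto[OF assms] by (rule LIMSEQ_ignore_initial_segment)
  moreover have "(\<lambda>m. qpoch a p (m + n)) \<longlonglongrightarrow> qpoch a p n * qpoch_inf (a * p ^ n) p"
    by (subst add.commute, subst qpoch_add) (intro tendsto_intros qpoch_tendsto assms)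
  ultimately show ?thesis by (rule LIMSEQ_unique)
qed

lemma qpoch_inf_bisect:
  assumes "norm p < 1"
  shows "qpoch_inf a p = qpoch_inf a (p ^ 2) * qpoch_inf (a * p) (p ^ 2)"
proof -
  have p2: "norm (p ^ 2) < 1" using assms by (simp add: norm_power power_less_one_iff)
  have eq: "qpoch a p (2 * n) = qpoch a (p ^ 2) n * qpoch (a * p) (p ^ 2) n" for n
    by (induction n) (simp_all add: qpoch_Suc power_mult[symmetric] mult_ac)
  have "(\<lambda>n. qpoch a p (2 * n)) \<longlonglongrightarrow> qpoch_inf a p"
    using LIMSEQ_subseq_LIMSEQ[OF qpoch_tendsto[OF assms], of "\<lambda>n. 2 * n"]
    by (simp add: strict_mono_def o_def)
  moreover have "(\<lambda>n. qpoch a p (2 * n)) \<longlonglongrightarrow> qpoch_inf a (p ^ 2) * qpoch_inf (a * p) (p ^ 2)"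
    unfolding eq by (intro tendsto_intros qpoch_tendsto p2)
  ultimately show ?thesis by (rule LIMSEQ_unique)
qed

lemma qpoch_neg_mult: "qpoch (- a) p n * qpoch a p n = qpoch (a ^ 2) (p ^ 2) n"
  by (induction n)
     (simp_all add: qpoch_Suc algebra_simps power2_eq_square power_mult_distrib)

lemma qpoch_inf_neg_mult:
  assumes "norm p < 1"
  shows "qpoch_inf (- a) p * qpoch_inf a p = qpoch_inf (a ^ 2) (p ^ 2)"
proof -
  have p2: "norm (p ^ 2) < 1" using assms by (simp add: norm_power power_less_one_iff)
  have "(\<lambda>n. qpoch (- a) p n * qpoch a p n) \<longlonglongrightarrow> qpoch_inf (- a) p * qpoch_inf a p"
    by (intro tendsto_intros qpoch_tendsto assms)
  with qpoch_tendsto[OF p2, of "a ^ 2"] show ?thesis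
    unfolding qpoch_neg_mult by (metis LIMSEQ_unique)
qed

section \<open>Euler's series for the infinite product\<close>

lemma Suc_choose_two: "Suc n choose 2 = (n choose 2) + n"
  by (simp add: numeral_2_eq_2)

lemma eight_choose_two: "8 * (n choose 2) + 4 * n = 4 * n ^ 2"
  by (induction n) (simp_all add: Suc_choose_two power2_eq_square)

text \<open>The ratio of consecutive terms is \<open>y ^ n * x\<close>, so the quadratic exponent beats any
  geometric growth in \<open>x\<close>.\<close>

lemma summable_gauss_power:
  fixes x y :: real
  assumes "0 \<le> x" "0 < y" "y < 1"
  shows "summable (\<lambda>n. y ^ (n choose 2) * x ^ n)"
proof -
  have "(\<lambda>n. y ^ n * x) \<longlonglongrightarrow> 0"
    using assms by (intro tendsto_mult_left_zero LIMSEQ_realpow_zero) auto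
  then have "eventually (\<lambda>n. y ^ n * x < 1/2) sequentially"
    by (rule order_tendstoD) simp
  then obtain N where N: "\<And>n. n \<ge> N \<Longrightarrow> y ^ n * x < 1/2"
    by (auto simp: eventually_sequentially)
  show ?thesis
  proof (rule summable_ratio_test[of "1/2" N])
    fix n assume "n \<ge> N"
    from N[OF this] have "(y ^ (n choose 2) * x ^ n) * (y ^ n * x) \<le> (y ^ (n choose 2) * x ^ n) * (1/2)"
      using assms by (intro mult_left_mono) auto
    then show "norm (y ^ (Suc n choose 2) * x ^ Suc n) \<le> 1/2 * norm (y ^ (n choose 2) * x ^ n)"
      using assms by (simp add: Suc_choose_two power_add mult_ac)
  qed simp
qed

lemma summable_norm_euler_terms:
  fixes p z :: complex
  assumes "0 < norm p" "norm p < 1"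
  shows "summable (\<lambda>n. norm (p ^ (n choose 2) * z ^ n / qpoch p p n))"
proof -
  obtain K where K: "K > 0" "\<And>n. inverse (norm (qpoch p p n)) \<le> K"
    using qpoch_bounds[OF assms(2) assms(2)] by metis
  have "summable (\<lambda>n. K * (norm p ^ (n choose 2) * norm z ^ n))"
    by (intro summable_mult summable_gauss_power) (use assms in auto)
  then show ?thesis
  proof (rule summable_comparison_test[rotated], intro exI allI impI)
    fix n
    show "norm (norm (p ^ (n choose 2) * z ^ n / qpoch p p n)) \<le> K * (norm p ^ (n choose 2) * norm z ^ n)"
      using mult_right_mono[OF K(2)[of n], of "norm p ^ (n choose 2) * norm z ^ n"]
      by (simp add: norm_mult norm_divide norm_power field_simps)
  qed
qed

text \<open>The series \<open>E z\<close> satisfies \<open>E z = (1 + z) * E (z * p)\<close>, by comparing coefficients. Iterating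
  splits off one factor of the product at a time and leaves \<open>E (z * p ^ n)\<close>, which tends to
  \<open>E 0 = 1\<close> because an everywhere convergent power series is continuous.\<close>

theorem euler_has_sum:
  fixes p z :: complex
  assumes p: "0 < norm p" "norm p < 1"
  shows "((\<lambda>n. p ^ (n choose 2) * z ^ n / qpoch p p n) has_sum qpoch_inf (- z) p) UNIV"
proof -
  define c where "c = (\<lambda>n. p ^ (n choose 2) / qpoch p p n)"
  define E where "E = (\<lambda>z. \<Sum>n. c n * z ^ n)"
  have sm: "summable (\<lambda>n. c n * z ^ n)" for z
    using summable_norm_euler_terms[OF p, of z] by (auto simp: c_def dest: summable_norm_cancel)
  have c_Suc: "c (Suc n) * (1 - p ^ Suc n) = c n * p ^ n" for n
    using one_minus_mult_power_neq_0[OF p(2) p(2), of n] qpoch_neq_0[OF p(2) p(2), of n]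
    by (simp add: c_def qpoch_Suc Suc_choose_two power_add)
  have step: "E z = (1 + z) * E (z * p)" for z
  proof -
    have "E z - E (z * p) = (\<Sum>n. c n * z ^ n - c n * (z * p) ^ n)"
      unfolding E_def by (intro suminf_diff sm)
    also have "\<dots> = (\<Sum>n. c (Suc n) * z ^ Suc n - c (Suc n) * (z * p) ^ Suc n)"
      by (subst suminf_split_head) (auto intro: summable_diff sm)
    also have "\<dots> = (\<Sum>n. z * (c n * (z * p) ^ n))"
    proof (rule suminf_cong)
      fix n
      have "c (Suc n) * z ^ Suc n - c (Suc n) * (z * p) ^ Suc n = (c (Suc n) * (1 - p ^ Suc n)) * z ^ Suc n"
        by (simp only: power_mult_distrib) (simp add: algebra_simps)
      then show "c (Suc n) * z ^ Suc n - c (Suc n) * (z * p) ^ Suc n = z * (c n * (z * p) ^ n)"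
        unfolding c_Suc by (simp add: power_mult_distrib mult_ac)
    qed
    also have "\<dots> = z * E (z * p)"
      unfolding E_def by (intro suminf_mult sm)
    finally show ?thesis by (simp add: algebra_simps)
  qed
  have iter: "E z = qpoch (- z) p n * E (z * p ^ n)" for n
  proof (induction n)
    case (Suc n)
    then show ?case by (subst (asm) step[of "z * p ^ n"]) (simp add: qpoch_Suc mult_ac)
  qed simp
  have "(\<lambda>n. z * p ^ n) \<longlonglongrightarrow> 0"
    by (intro tendsto_mult_right_zero LIMSEQ_power_zero p)
  moreover have "isCont E 0"
    unfolding E_def by (rule isCont_powser_converges_everywhere[OF sm])
  ultimately have "(\<lambda>n. E (z * p ^ n)) \<longlonglongrightarrow> E 0"
    by (intro isCont_tendsto_compose[of 0 E])
  moreover have "E 0 = 1"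
    unfolding E_def powser_zero by (simp add: c_def binomial_eq_0)
  ultimately have "(\<lambda>n. qpoch (- z) p n * E (z * p ^ n)) \<longlonglongrightarrow> qpoch_inf (- z) p * 1"
    using qpoch_tendsto[OF p(2)] by (intro tendsto_mult) auto
  then have "(\<lambda>n::nat. E z) \<longlonglongrightarrow> qpoch_inf (- z) p * 1"
    unfolding iter[symmetric] .
  then have "E z = qpoch_inf (- z) p"
    by (simp add: LIMSEQ_const_iff)
  then have "(\<lambda>n. c n * z ^ n) sums qpoch_inf (- z) p"
    using summable_sums[OF sm[of z]] by (simp add: E_def)
  then show ?thesis
    by (intro norm_summable_imp_has_sum summable_norm_euler_terms p) (simp add: c_def)
qed

section \<open>Dominated convergence and sums over the integers\<close>

text \<open>A bound that is summable in \<open>x\<close> and independent of \<open>n\<close> makes the finite partial sums converge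
  uniformly in \<open>n\<close> (the Weierstrass M-test), so the two limits may be exchanged.\<close>

lemma infsum_dominated_convergence:
  fixes f :: "nat \<Rightarrow> 'a \<Rightarrow> 'b :: banach"
  assumes bound: "\<And>n x. x \<in> A \<Longrightarrow> norm (f n x) \<le> M x" and M: "M summable_on A"
    and f: "\<And>n. (f n has_sum S n) A"
    and lim: "\<And>x. x \<in> A \<Longrightarrow> (\<lambda>n. f n x) \<longlonglongrightarrow> g x"
  shows "g summable_on A" and "S \<longlonglongrightarrow> infsum g A"
proof -
  have "norm (g x) \<le> M x" if "x \<in> A" for x
    using tendsto_norm[OF lim[OF that]] bound[OF that] by (intro LIMSEQ_le_const2) auto
  then have "(\<lambda>x. norm (g x)) summable_on A"
    by (intro Infinite_Sum.abs_summable_on_comparison_test'[OF M])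
  then show g: "g summable_on A"
    by (rule abs_summable_summable)
  show "S \<longlonglongrightarrow> infsum g A"
  proof (rule swap_uniform_limit')
    show "uniform_limit UNIV (\<lambda>X n. \<Sum>x\<in>X. f n x) S (finite_subsets_at_top A)"
      using bound f M by (intro Weierstrass_m_test_general') auto
    show "((\<lambda>X. sum g X) \<longlongrightarrow> infsum g A) (finite_subsets_at_top A)"
      using g unfolding has_sum_def[symmetric] by simp
    show "\<forall>\<^sub>F X in finite_subsets_at_top A. (\<lambda>n. \<Sum>x\<in>X. f n x) \<longlonglongrightarrow> sum g X"
    proof (rule eventually_mono[OF eventually_finite_subsets_at_top_weakI])
      fix X assume "X \<subseteq> A"
      then show "(\<lambda>n. \<Sum>x\<in>X. f n x) \<longlonglongrightarrow> sum g X"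
        by (intro tendsto_sum lim) auto
    qed
  qed auto
qed

lemma bij_betw_int_nonneg: "bij_betw int UNIV {0..}"
  by (rule bij_betwI[where g = nat]) auto

lemma bij_betw_int_neg: "bij_betw (\<lambda>n. - 1 - int n) UNIV {..<0}"
  by (rule bij_betwI[where g = "\<lambda>k. nat (- 1 - k)"]) auto

lemma int_UNIV_split: "(UNIV :: int set) = {0..} \<union> {..<0}"
  by auto

lemma summable_on_int:
  fixes f :: "int \<Rightarrow> 'a :: banach"
  assumes "(\<lambda>n. f (int n)) summable_on UNIV" "(\<lambda>n. f (- 1 - int n)) summable_on UNIV"
  shows "f summable_on UNIV"
  unfolding int_UNIV_split
  using assms summable_on_reindex_bij_betw[OF bij_betw_int_nonneg, of f]
    summable_on_reindex_bij_betw[OF bij_betw_int_neg, of f]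
  by (intro summable_on_Un_disjoint) auto

text \<open>The pairing of \<open>n\<close> with \<open>- 1 - n\<close> turns the theta series into the one-sided alternating
  series produced by the well-poised sums below.\<close>

lemma has_sum_int_fold:
  fixes f :: "int \<Rightarrow> 'a :: banach"
  assumes "(f has_sum S) UNIV"
  shows "((\<lambda>n. f (int n) + f (- 1 - int n)) has_sum S) UNIV"
proof -
  have f: "f summable_on UNIV"
    using assms by (auto simp: summable_on_def)
  obtain a b where a: "(f has_sum a) {0..}" and b: "(f has_sum b) {..<0}"
    using summable_on_subset_banach[OF f, of "{0..}"] summable_on_subset_banach[OF f, of "{..<0}"]
    by (auto simp: summable_on_def)
  have "(f has_sum (a + b)) UNIV"
    unfolding int_UNIV_split by (intro has_sum_Un_disjoint a b) auto
  with assms have "S = a + b"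
    by (rule has_sum_unique)
  moreover have "((\<lambda>n. f (int n)) has_sum a) UNIV" "((\<lambda>n. f (- 1 - int n)) has_sum b) UNIV"
    using a b has_sum_reindex_bij_betw[OF bij_betw_int_nonneg, of f a]
      has_sum_reindex_bij_betw[OF bij_betw_int_neg, of f b] by auto
  ultimately show ?thesis
    by (auto intro: has_sum_add)
qed

section \<open>The Jacobi triple product\<close>

definition tri :: "int \<Rightarrow> int" where
  "tri k = k * (k - 1) div 2"

lemma tri_double: "2 * tri k = k * (k - 1)"
  unfolding tri_def by (rule dvd_mult_div_cancel) auto

lemma tri_add_1: "tri (k + 1) = tri k + k"
  using tri_double[of k] tri_double[of "k + 1"] by (simp add: algebra_simps)

lemma tri_diff_1: "tri (k - 1) = tri k - (k - 1)"
  using tri_add_1[of "k - 1"] by simp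

lemma tri_int: "tri (int n) = int (n choose 2)"
proof (induction n)
  case (Suc n)
  then show ?case using tri_add_1[of "int n"] by (simp add: Suc_choose_two add.commute)
qed (simp add: tri_def)

lemma tri_neg: "tri (- 1 - int n) = int (n choose 2) + 2 * int n + 1"
  using tri_double[of "- 1 - int n"] tri_double[of "int n"] by (simp add: tri_int algebra_simps)

text \<open>The summand of the two-sided theta series \<open>\<Sum>k. (-1)^k z^k p^(k(k-1)/2)\<close>.\<close>

definition theta_term :: "complex \<Rightarrow> complex \<Rightarrow> int \<Rightarrow> complex" where
  "theta_term z p k = p powi tri k * (- z) powi k"

text \<open>The reciprocal of \<open>(p;p)\<^sub>m\<close>, extended by zero to negative indices just as \<open>1 / m!\<close> is. This is
  the extension under which the rule \<open>inv_qfact_diff_1\<close> holds at all integers, so that the coefficients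
  of the finite triple product satisfy their recurrence without boundary cases.\<close>

definition inv_qfact :: "complex \<Rightarrow> int \<Rightarrow> complex" where
  "inv_qfact p m = (if m < 0 then 0 else inverse (qpoch p p (nat m)))"

lemma inv_qfact_diff_1:
  assumes "0 < norm p" "norm p < 1"
  shows "inv_qfact p (m - 1) = (1 - p powi m) * inv_qfact p m"
proof (cases "m \<le> 0")
  case False
  then obtain n where n: "m = int (Suc n)"
    by (metis not_le pos_int_cases Suc_pred)
  have "qpoch p p n \<noteq> 0" "1 - p * p ^ n \<noteq> 0"
    using qpoch_neq_0 one_minus_mult_power_neq_0 assms by auto
  then show ?thesis
    unfolding n by (simp add: inv_qfact_def qpoch_Suc field_simps power_int_def nat_add_distrib)
qed (auto simp: inv_qfact_def)

text \<open>Passing from \<open>n\<close> to \<open>n + 1\<close> multiplies the right-hand side by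
  \<open>(1 - z p^n) (1 - p^(n+1) / z) = 1 + p^(2n+1) - p^n z - p^(n+1) / z\<close> and divides it by two
  factors of \<open>(p;p)\<^sub>2\<^sub>n\<^sub>+\<^sub>2\<close>. On the coefficients this is a recurrence that relates index \<open>k\<close> to
  \<open>k - 1\<close>, \<open>k\<close> and \<open>k + 1\<close>, which the explicit coefficients satisfy.\<close>

lemma finite_jacobi_triple:
  assumes p: "0 < norm p" "norm p < 1" and z: "z \<noteq> 0"
  shows "((\<lambda>k. theta_term z p k * (inv_qfact p (int n - k) * inv_qfact p (int n + k))) has_sum
           qpoch z p n * qpoch (p / z) p n / qpoch p p (2 * n)) UNIV"
proof (induction n)
  case 0
  show ?case
    by (rule has_sum_finite_neutralI[of "{0}"])
       (auto simp: inv_qfact_def theta_term_def tri_def)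
next
  case (Suc n)
  define u where "u = (\<lambda>n k. theta_term z p k * (inv_qfact p (int n - k) * inv_qfact p (int n + k)))"
  define R where "R = qpoch z p n * qpoch (p / z) p n / qpoch p p (2 * n)"
  define D where "D = (1 - p ^ (2 * n + 1)) * (1 - p ^ (2 * n + 2))"
  have p0: "p \<noteq> 0" using p by auto
  have D0: "D \<noteq> 0"
    using one_minus_mult_power_neq_0[OF p(2) p(2), of "2 * n"] one_minus_mult_power_neq_0[OF p(2) p(2), of "2 * n + 1"]
    by (simp add: D_def)
  have u: "(u n has_sum R) UNIV"
    using Suc by (simp add: u_def R_def)
  have u_prev: "((\<lambda>k. u n (k - 1)) has_sum R) UNIV"
    using u by (subst has_sum_reindex_bij_betw) (auto intro: bij_betwI[where g = "\<lambda>k. k + 1"])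
  have u_next: "((\<lambda>k. u n (k + 1)) has_sum R) UNIV"
    using u by (subst has_sum_reindex_bij_betw) (auto intro: bij_betwI[where g = "\<lambda>k. k - 1"])
  have rec: "D * u (Suc n) k =
      (1 + p ^ (2 * n + 1)) * u n k + (- (z * p ^ n) * u n (k - 1) + - (p ^ (n + 1) / z) * u n (k + 1))" for k
  proof -
    (* In these letters the recurrence is an identity between rational functions. *)
    define N X G A B where "N = p ^ n" and "X = p powi k" and "G = theta_term z p k"
      and "A = inv_qfact p (int n + 1 - k)" and "B = inv_qfact p (int n + 1 + k)"
    have nz: "X \<noteq> 0" "N \<noteq> 0" using p0 by (auto simp: X_def N_def)
    have pw: "p powi (int n + 1 - k) = N * p / X" "p powi (int n + 1 + k) = N * p * X"
      "p powi (int n - k) = N / X" "p powi (int n + k) = N * X"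
      using p0 by (simp_all add: N_def X_def power_int_add power_int_diff)
    have 1: "inv_qfact p (int n - k) = (1 - N * p / X) * A"
      using inv_qfact_diff_1[OF p, of "int n + 1 - k"] by (simp add: A_def pw)
    have 2: "inv_qfact p (int n + k) = (1 - N * p * X) * B"
      using inv_qfact_diff_1[OF p, of "int n + 1 + k"] by (simp add: B_def pw)
    have shift: "int n - (k + 1) = int n - k - 1" "int n + (k - 1) = int n + k - 1" by simp_all
    have 3: "inv_qfact p (int n - (k + 1)) = (1 - N / X) * ((1 - N * p / X) * A)"
      by (simp only: shift inv_qfact_diff_1[OF p, of "int n - k"] 1 pw)
    have 4: "inv_qfact p (int n + (k - 1)) = (1 - N * X) * ((1 - N * p * X) * B)"
      by (simp only: shift inv_qfact_diff_1[OF p, of "int n + k"] 2 pw)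
    have 5: "inv_qfact p (int n - (k - 1)) = A" "inv_qfact p (int n + (k + 1)) = B"
      by (simp_all add: A_def B_def algebra_simps)
    have G1: "theta_term z p (k + 1) = - (G * X * z)"
      using p0 z by (simp add: G_def X_def theta_term_def tri_add_1 power_int_add)
    have G2: "theta_term z p (k - 1) = - (G * p / (X * z))"
      using p0 z by (simp add: G_def X_def theta_term_def tri_diff_1 power_int_diff power_int_add field_simps)
    have NN0: "p ^ (2 * n) = N * N" by (simp add: N_def mult_2 power_add)
    have D: "D = (1 - N * N * p) * (1 - N * N * p * p)"
      unfolding D_def power_add NN0 by (simp add: power2_eq_square mult_ac)
    have NN: "p ^ (2 * n + 1) = N * N * p" "p ^ (n + 1) = N * p"
      unfolding power_add NN0 by (simp_all add: N_def)
    have u1: "u (Suc n) k = G * (A * B)"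
      by (simp add: u_def G_def A_def B_def add.commute)
    have u2: "u n k = G * ((1 - N * p / X) * A * ((1 - N * p * X) * B))"
      unfolding u_def 1 2 G_def ..
    have u3: "u n (k - 1) = - (G * p / (X * z)) * (A * ((1 - N * X) * ((1 - N * p * X) * B)))"
      unfolding u_def 4 5 G2 ..
    have u4: "u n (k + 1) = - (G * X * z) * ((1 - N / X) * ((1 - N * p / X) * A) * B)"
      unfolding u_def 3 5 G1 ..
    show ?thesis
      unfolding u1 u2 u3 u4 D NN N_def[symmetric] using nz z by (simp add: field_simps)
  qed
  have "((\<lambda>k. D * u (Suc n) k) has_sum
      (1 + p ^ (2 * n + 1)) * R + (- (z * p ^ n) * R + - (p ^ (n + 1) / z) * R)) UNIV"
    unfolding rec by (intro has_sum_add has_sum_cmult_right u u_prev u_next)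
  also have "(1 + p ^ (2 * n + 1)) * R + (- (z * p ^ n) * R + - (p ^ (n + 1) / z) * R)
      = (1 - z * p ^ n) * (1 - p / z * p ^ n) * R"
  proof -
    have "p ^ (2 * n + 1) = p ^ n * p ^ (n + 1)" by (simp add: mult_2 power_add)
    then show ?thesis using z by (simp add: field_simps)
  qed
  finally have "(u (Suc n) has_sum (1 - z * p ^ n) * (1 - p / z * p ^ n) * R / D) UNIV"
    using has_sum_cmult_right_iff[OF D0, of "u (Suc n)"] by simp
  moreover have "(1 - z * p ^ n) * (1 - p / z * p ^ n) * R / D =
     qpoch z p (Suc n) * qpoch (p / z) p (Suc n) / qpoch p p (2 * Suc n)"
    by (simp add: R_def D_def qpoch_Suc mult_ac)
  ultimately show ?case by (simp add: u_def)
qed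

text \<open>The limit \<open>n \<rightarrow> \<infinity>\<close> of the finite identity: each reciprocal factor tends to
  \<open>1 / (p;p)\<^sub>\<infinity>\<close>, and their boundedness leaves a multiple of the theta series as dominating series.\<close>

theorem jacobi_triple_product:
  assumes p: "0 < norm p" "norm p < 1" and z: "z \<noteq> 0"
  shows "(theta_term z p has_sum qpoch_inf z p * qpoch_inf (p / z) p * qpoch_inf p p) UNIV"
proof -
  let ?c = "qpoch_inf p p"
  obtain K where K: "K > 0" "\<And>n. inverse (norm (qpoch p p n)) \<le> K"
    using qpoch_bounds[OF p(2) p(2)] by metis
  have p0: "p \<noteq> 0" and c0: "?c \<noteq> 0" using p qpoch_inf_neq_0 by auto
  have inv_bound: "norm (inv_qfact p m) \<le> K" for m
    using K by (simp add: inv_qfact_def norm_inverse)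
  have inv_lim: "(\<lambda>n. inv_qfact p (int n + k)) \<longlonglongrightarrow> inverse ?c" for k
  proof -
    have "filterlim (\<lambda>n. nat (int n + k)) at_top sequentially"
      unfolding filterlim_at_top
    proof
      fix Z show "\<forall>\<^sub>F n in sequentially. Z \<le> nat (int n + k)"
        using eventually_ge_at_top[of "Z + nat \<bar>k\<bar>"] by eventually_elim auto
    qed
    then have "(\<lambda>n. inverse (qpoch p p (nat (int n + k)))) \<longlonglongrightarrow> inverse ?c"
      by (intro tendsto_inverse c0 filterlim_compose[OF qpoch_tendsto[OF p(2)]])
    moreover have "\<forall>\<^sub>F n in sequentially. inverse (qpoch p p (nat (int n + k))) = inv_qfact p (int n + k)"
      using eventually_ge_at_top[of "nat \<bar>k\<bar>"] by eventually_elim (auto simp: inv_qfact_def)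
    ultimately show ?thesis by (rule Lim_transform_eventually)
  qed
  have "summable (\<lambda>n. norm p ^ (n choose 2) * norm z ^ n)"
    by (intro summable_gauss_power) (use p in auto)
  then have 1: "(\<lambda>n. norm (theta_term z p (int n))) summable_on UNIV"
    by (intro norm_summable_imp_summable_on)
       (simp add: theta_term_def tri_int norm_mult norm_power)
  have "summable (\<lambda>n. norm p / norm z * (norm p ^ (n choose 2) * (norm p ^ 2 / norm z) ^ n))"
    by (intro summable_mult summable_gauss_power) (use p in auto)
  also have "(\<lambda>n. norm p / norm z * (norm p ^ (n choose 2) * (norm p ^ 2 / norm z) ^ n)) =
      (\<lambda>n. norm (theta_term z p (- 1 - int n)))"
  proof
    fix n
    have "theta_term z p (- 1 - int n) = p ^ ((n choose 2) + 2 * n + 1) / (- z) ^ (n + 1)"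
    proof -
      have "int (n choose 2) + 2 * int n + 1 = int ((n choose 2) + 2 * n + 1)" by simp
      moreover have "- 1 - int n = - int (n + 1)" by simp
      ultimately show ?thesis
        unfolding theta_term_def tri_neg by (simp only: power_int_minus power_int_of_nat divide_inverse)
    qed
    then show "norm p / norm z * (norm p ^ (n choose 2) * (norm p ^ 2 / norm z) ^ n) =
      norm (theta_term z p (- 1 - int n))"
      by (simp add: norm_divide norm_mult norm_power power_add power_divide power_mult[symmetric] mult.commute[of 2] field_simps)
  qed
  finally have 2: "(\<lambda>n. norm (theta_term z p (- 1 - int n))) summable_on UNIV"
    by (intro norm_summable_imp_summable_on) simp
  from 1 2 have "(\<lambda>k. norm (theta_term z p k)) summable_on UNIV"
    by (rule summable_on_int)
  then have M: "(\<lambda>k. norm (theta_term z p k) * (K * K)) summable_on UNIV"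
    by (rule summable_on_cmult_left)
  let ?g = "\<lambda>k. theta_term z p k * (inverse ?c * inverse ?c)"
  have dom: "norm (theta_term z p k * (inv_qfact p (int n - k) * inv_qfact p (int n + k)))
      \<le> norm (theta_term z p k) * (K * K)" for n k
    unfolding norm_mult by (intro mult_left_mono mult_mono inv_bound) (use K in auto)
  have lim: "(\<lambda>n. theta_term z p k * (inv_qfact p (int n - k) * inv_qfact p (int n + k))) \<longlonglongrightarrow> ?g k" for k
    using inv_lim[of "- k"] inv_lim[of k] by (intro tendsto_intros) auto
  note dct = infsum_dominated_convergence[OF dom M finite_jacobi_triple[OF p z] lim]
  have "(\<lambda>n. qpoch p p (2 * n)) \<longlonglongrightarrow> ?c"
    using LIMSEQ_subseq_LIMSEQ[OF qpoch_tendsto[OF p(2)], of "\<lambda>n. 2 * n"]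
    by (simp add: strict_mono_def o_def)
  then have "(\<lambda>n. qpoch z p n * qpoch (p / z) p n / qpoch p p (2 * n))
      \<longlonglongrightarrow> qpoch_inf z p * qpoch_inf (p / z) p / ?c"
    by (intro tendsto_intros qpoch_tendsto p c0)
  with dct(2) have "infsum ?g UNIV = qpoch_inf z p * qpoch_inf (p / z) p / ?c"
    by (rule LIMSEQ_unique)
  with dct(1) have "(?g has_sum qpoch_inf z p * qpoch_inf (p / z) p / ?c) UNIV"
    by (simp add: has_sum_iff)
  from has_sum_cmult_left[OF this, of "?c * ?c"] c0 show ?thesis
    by (simp add: field_simps)
qed

section \<open>Summing out two of the three variables\<close>

lemma Sigma_UNIV_UNIV: "(SIGMA x:UNIV. UNIV) = UNIV"
  by simp

lemma summable_on_product_UNIV: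
  fixes f :: "'a \<Rightarrow> real" and g :: "'b \<Rightarrow> real"
  assumes "f summable_on UNIV" "g summable_on UNIV" "\<And>x. f x \<ge> 0" "\<And>y. g y \<ge> 0"
  shows "(\<lambda>(x, y). f x * g y) summable_on UNIV"
proof -
  have "(\<lambda>(x, y). f x * g y) summable_on (SIGMA x:UNIV. UNIV)"
  proof (rule summable_on_SigmaI)
    show "((\<lambda>y. case (x, y) of (x, y) \<Rightarrow> f x * g y) has_sum f x * infsum g UNIV) UNIV" for x
      using assms(2) by (auto intro!: has_sum_cmult_right)
    show "(\<lambda>x. f x * infsum g UNIV) summable_on UNIV"
      using assms(1) by (rule summable_on_cmult_left)
  qed (use assms in auto)
  then show ?thesis by simp
qed

text \<open>Both \<open>2 j^2 - 2 j\<close> and \<open>k^2 - k\<close> are multiples of binomial coefficients. Hence for a linear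
  coefficient of \<open>j\<close> that is at least \<open>-2\<close> the exponent is a natural number, in the form that
  Euler's series requires.\<close>

lemma qexponent_eq:
  "qexponent (int B - 2) (int c) i j k =
     int ((Suc i choose 2) + 4 * (j choose 2) + B * j + 2 * (k choose 2) + (c + 1) * k + i * j + 2 * j * k)"
proof -
  have ch: "2 * int (n choose 2) = int n ^ 2 - int n" for n
    using tri_double[of "int n"] by (simp add: tri_int power2_eq_square algebra_simps)
  have "(int i ^ 2 + int i) div 2 = int (Suc i choose 2)"
    using ch[of "Suc i"] by (simp add: power2_eq_square algebra_simps)
  then show ?thesis
    using ch[of j] ch[of k] by (simp add: qexponent_def algebra_simps)
qed

text \<open>Once \<open>j\<close> is fixed, the summand is a product of an Euler series term in \<open>k\<close> and one in \<open>i\<close>.\<close>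

lemma qsummand_factor:
  "qsummand q (int B - 2) (int c) (i, j, k) =
     ((q ^ 4) ^ (j choose 2) * (q ^ B) ^ j / qpoch q q j) *
     (((q ^ 2) ^ (k choose 2) * (q ^ (2 * j + c + 1)) ^ k / qpoch (q ^ 2) (q ^ 2) k) *
      (q ^ (i choose 2) * (q ^ (j + 1)) ^ i / qpoch q q i))"
proof -
  have e: "q powi qexponent (int B - 2) (int c) i j k =
    (q ^ 4) ^ (j choose 2) * (q ^ B) ^ j * ((q ^ 2) ^ (k choose 2) * (q ^ (2 * j + c + 1)) ^ k) *
    (q ^ (i choose 2) * (q ^ (j + 1)) ^ i)"
    unfolding qexponent_eq power_int_of_nat power_mult[symmetric] power_add[symmetric]
    by (rule arg_cong[where f = "\<lambda>n. q ^ n"]) (simp add: Suc_choose_two algebra_simps)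
  have frac: "x * y * z / (a * b * d) = (x / b) * ((y / d) * (z / a))" for x y z a b d :: complex
    by (simp add: mult_ac)
  show ?thesis
    unfolding qsummand_def prod.case e by (rule frac)
qed

text \<open>The exponent is at least \<open>i + (j - 1) + k\<close>, with truncated subtraction, so the triple series is
  dominated by a product of three geometric series.\<close>

lemma qsummand_summable:
  fixes q :: complex
  assumes q: "0 < norm q" "norm q < 1"
  shows "qsummand q (int B - 2) (int c) summable_on UNIV"
proof -
  have q2: "norm (q ^ 2) < 1" using q by (simp add: norm_power power_less_one_iff)
  obtain K where K: "K > 0" "\<And>n. inverse (norm (qpoch q q n)) \<le> K"
    using qpoch_bounds[OF q(2) q(2)] by metis
  obtain L where L: "L > 0" "\<And>n. inverse (norm (qpoch (q ^ 2) (q ^ 2) n)) \<le> L"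
    using qpoch_bounds[OF q2 q2] by metis
  define r where "r = norm q"
  have r: "0 < r" "r < 1" using q by (auto simp: r_def)
  have geo: "(\<lambda>n. r ^ n) summable_on UNIV"
    using r by (intro norm_summable_imp_summable_on) (simp add: norm_power)
  have "summable (\<lambda>n. r ^ (n - 1))"
    using r by (subst summable_Suc_iff[symmetric]) simp
  then have geo': "(\<lambda>n. r ^ (n - 1)) summable_on UNIV"
    using r by (intro norm_summable_imp_summable_on) (simp add: norm_power)
  have "(\<lambda>(i, j, k). r ^ i * (r ^ (j - 1) * r ^ k)) summable_on (UNIV :: (nat \<times> nat \<times> nat) set)"
    using summable_on_product_UNIV[OF geo summable_on_product_UNIV[OF geo' geo]] r
    by (simp add: case_prod_unfold)
  then have M: "(\<lambda>(i, j, k). r ^ i * (r ^ (j - 1) * r ^ k) * (K * K * L)) summable_on (UNIV :: (nat \<times> nat \<times> nat) set)"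
    using summable_on_cmult_left[of "\<lambda>(i, j, k). r ^ i * (r ^ (j - 1) * r ^ k)" UNIV "K * K * L"]
    by (simp add: case_prod_unfold)
  have "(\<lambda>x. norm (qsummand q (int B - 2) (int c) x)) summable_on UNIV"
  proof (rule Infinite_Sum.abs_summable_on_comparison_test'[OF M])
    fix x :: "nat \<times> nat \<times> nat"
    obtain i j k where x: "x = (i, j, k)" by (cases x)
    define E where "E = (Suc i choose 2) + 4 * (j choose 2) + B * j + 2 * (k choose 2) + (c + 1) * k + i * j + 2 * j * k"
    have "j - 1 \<le> 4 * (j choose 2)"
    proof (cases j)
      case (Suc n)
      then show ?thesis by (simp add: Suc_choose_two)
    qed simp
    then have "i + (j - 1 + k) \<le> E"
      unfolding E_def by (auto simp: Suc_choose_two intro: le_trans[of _ "(i + 4 * (j choose 2)) + k"])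
    then have "r ^ E \<le> r ^ (i + (j - 1 + k))"
      using r by (intro power_decreasing) auto
    then have 1: "r ^ E \<le> r ^ i * (r ^ (j - 1) * r ^ k)"
      by (simp add: power_add)
    have "norm (qsummand q (int B - 2) (int c) x) =
      r ^ E * (inverse (norm (qpoch q q i)) * inverse (norm (qpoch q q j)) * inverse (norm (qpoch (q ^ 2) (q ^ 2) k)))"
      unfolding x qsummand_def prod.case qexponent_eq E_def[symmetric] power_int_of_nat
      by (simp add: norm_divide norm_mult norm_inverse norm_power r_def divide_inverse)
    also have "\<dots> \<le> (r ^ i * (r ^ (j - 1) * r ^ k)) * (K * K * L)"
      using r K(1) L(1) by (intro mult_mono 1 K L) auto
    finally show "norm (qsummand q (int B - 2) (int c) x) \<le>
      (case x of (i, j, k) \<Rightarrow> r ^ i * (r ^ (j - 1) * r ^ k) * (K * K * L))"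
      by (simp add: x)
  qed
  then show ?thesis by (rule abs_summable_summable)
qed

text \<open>Euler's series gives \<open>(-q^(j+1);q)\<^sub>\<infinity> = (-q;q)\<^sub>\<infinity> / (-q;q)\<^sub>j\<close> for the sum over \<open>i\<close> and
  \<open>(-q^(2j+c+1);q^2)\<^sub>\<infinity>\<close> for the sum over \<open>k\<close>. The denominators \<open>(q;q)\<^sub>j\<close> and \<open>(-q;q)\<^sub>j\<close> combine to
  \<open>(q^2;q^2)\<^sub>j\<close>, and a single series over \<open>j\<close> remains.\<close>

theorem qsummand_has_sum:
  fixes q :: complex
  assumes q: "0 < norm q" "norm q < 1"
    and T: "((\<lambda>j. (q ^ 4) ^ (j choose 2) * (q ^ B) ^ j / qpoch (q ^ 2) (q ^ 2) j *
                qpoch_inf (- (q ^ (2 * j + c + 1))) (q ^ 2)) has_sum T) UNIV"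
  shows "(qsummand q (int B - 2) (int c) has_sum qpoch_inf (- q) q * T) UNIV"
proof -
  have q2: "0 < norm (q ^ 2)" "norm (q ^ 2) < 1" using q by (auto simp: norm_power power_less_one_iff)
  define f where "f = (\<lambda>j k i. qsummand q (int B - 2) (int c) (i, j, k))"
  have bij: "bij_betw (\<lambda>(j, k, i). (i, j, k)) (UNIV :: (nat \<times> nat \<times> nat) set) UNIV"
    by (rule bij_betwI[where g = "\<lambda>(i, j, k). (j, k, i)"]) auto
  have "(\<lambda>x. qsummand q (int B - 2) (int c) (case x of (j, k, i) \<Rightarrow> (i, j, k))) summable_on UNIV"
    using summable_on_reindex_bij_betw[OF bij] qsummand_summable[OF q] by blast
  then have sm: "(\<lambda>(j, k, i). f j k i) summable_on UNIV"
    by (simp add: f_def case_prod_unfold)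
  have row: "((\<lambda>(k, i). f j k i) has_sum qpoch_inf (- q) q *
      ((q ^ 4) ^ (j choose 2) * (q ^ B) ^ j / qpoch (q ^ 2) (q ^ 2) j *
                qpoch_inf (- (q ^ (2 * j + c + 1))) (q ^ 2))) UNIV" for j
  proof -
    define u where "u = (q ^ 4) ^ (j choose 2) * (q ^ B) ^ j / qpoch q q j"
    define v where "v = (\<lambda>k. (q ^ 2) ^ (k choose 2) * (q ^ (2 * j + c + 1)) ^ k / qpoch (q ^ 2) (q ^ 2) k)"
    define w where "w = (\<lambda>i. q ^ (i choose 2) * (q ^ (j + 1)) ^ i / qpoch q q i)"
    have f: "f j k i = u * (v k * w i)" for k i
      by (simp add: f_def u_def v_def w_def qsummand_factor)
    have "((\<lambda>(k, i). f j k i) has_sum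
        u * (qpoch_inf (- (q ^ (2 * j + c + 1))) (q ^ 2) * qpoch_inf (- (q ^ (j + 1))) q)) (SIGMA k:UNIV. UNIV)"
    proof (rule has_sum_SigmaI)
      have w: "(w has_sum qpoch_inf (- (q ^ (j + 1))) q) UNIV"
        unfolding w_def by (rule euler_has_sum[OF q])
      show "((\<lambda>i. case (k, i) of (k, i) \<Rightarrow> f j k i) has_sum u * (v k * qpoch_inf (- (q ^ (j + 1))) q)) UNIV" for k
        unfolding f prod.case by (intro has_sum_cmult_right w)
      have "(v has_sum qpoch_inf (- (q ^ (2 * j + c + 1))) (q ^ 2)) UNIV"
        unfolding v_def by (rule euler_has_sum[OF q2])
      then show "((\<lambda>k. u * (v k * qpoch_inf (- (q ^ (j + 1))) q)) has_sum
        u * (qpoch_inf (- (q ^ (2 * j + c + 1))) (q ^ 2) * qpoch_inf (- (q ^ (j + 1))) q)) UNIV"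
        by (intro has_sum_cmult_right has_sum_cmult_left)
      show "(\<lambda>(k, i). f j k i) summable_on (SIGMA k:UNIV. UNIV)"
        using summable_on_SigmaD1[of "\<lambda>j (k, i). f j k i" UNIV "\<lambda>_. UNIV" j] sm by simp
    qed
    moreover have uw: "u * qpoch_inf (- (q ^ (j + 1))) q =
      qpoch_inf (- q) q * ((q ^ 4) ^ (j choose 2) * (q ^ B) ^ j / qpoch (q ^ 2) (q ^ 2) j)"
    proof -
      have "qpoch_inf (- q) q = qpoch (- q) q j * qpoch_inf (- (q ^ (j + 1))) q"
        using qpoch_inf_unfold[OF q(2), of "- q" j] by simp
      moreover have "qpoch (- q) q j * qpoch q q j = qpoch (q ^ 2) (q ^ 2) j"
        by (rule qpoch_neg_mult)
      moreover have "qpoch (q ^ 2) (q ^ 2) j \<noteq> 0" "qpoch q q j \<noteq> 0"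
        using qpoch_neq_0 q q2 by auto
      ultimately show ?thesis
        by (simp add: u_def field_simps)
    qed
    moreover have "u * (x * qpoch_inf (- (q ^ (j + 1))) q) = qpoch_inf (- q) q *
      ((q ^ 4) ^ (j choose 2) * (q ^ B) ^ j / qpoch (q ^ 2) (q ^ 2) j * x)" for x
      by (subst mult.left_commute, subst uw) (simp only: mult_ac)
    ultimately show ?thesis by (simp only: Sigma_UNIV_UNIV)
  qed
  have "((\<lambda>(j, k, i). f j k i) has_sum qpoch_inf (- q) q * T) (SIGMA j:UNIV. UNIV)"
  proof (rule has_sum_SigmaI)
    show "((\<lambda>y. case (j, y) of (j, k, i) \<Rightarrow> f j k i) has_sum qpoch_inf (- q) q *
      ((q ^ 4) ^ (j choose 2) * (q ^ B) ^ j / qpoch (q ^ 2) (q ^ 2) j *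
                qpoch_inf (- (q ^ (2 * j + c + 1))) (q ^ 2))) UNIV" for j
      using row[of j] by simp
    show "((\<lambda>j. qpoch_inf (- q) q *
      ((q ^ 4) ^ (j choose 2) * (q ^ B) ^ j / qpoch (q ^ 2) (q ^ 2) j *
                qpoch_inf (- (q ^ (2 * j + c + 1))) (q ^ 2))) has_sum qpoch_inf (- q) q * T) UNIV"
      by (intro has_sum_cmult_right T)
  qed (use sm in simp)
  then have "((\<lambda>x. qsummand q (int B - 2) (int c) (case x of (j, k, i) \<Rightarrow> (i, j, k))) has_sum
       qpoch_inf (- q) q * T) UNIV"
    by (simp add: f_def case_prod_unfold)
  then show ?thesis
    using has_sum_reindex_bij_betw[OF bij] by blast
qed

text \<open>For \<open>c = 1\<close> the factor \<open>(-q^(2j+2);q^2)\<^sub>\<infinity> = (-q^2;q^2)\<^sub>\<infinity> / (-q^2;q^2)\<^sub>j\<close> again combines with the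
  denominator, to \<open>(q^4;q^4)\<^sub>j\<close>, so that the series over \<open>j\<close> is Euler's with base \<open>q^4\<close>. This amounts to
  Lebesgue's identity.\<close>

lemma qsummand_has_sum_lebesgue:
  fixes q :: complex
  assumes q: "0 < norm q" "norm q < 1"
  shows "(qsummand q (int B - 2) 1 has_sum
     qpoch_inf (- q) q * (qpoch_inf (- (q ^ 2)) (q ^ 2) * qpoch_inf (- (q ^ B)) (q ^ 4))) UNIV"
proof -
  have q2: "0 < norm (q ^ 2)" "norm (q ^ 2) < 1" and q4: "0 < norm (q ^ 4)" "norm (q ^ 4) < 1"
    using q by (auto simp: norm_power power_less_one_iff)
  have "(q ^ 4) ^ (j choose 2) * (q ^ B) ^ j / qpoch (q ^ 2) (q ^ 2) j *
          qpoch_inf (- (q ^ (2 * j + 1 + 1))) (q ^ 2) =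
        qpoch_inf (- (q ^ 2)) (q ^ 2) * ((q ^ 4) ^ (j choose 2) * (q ^ B) ^ j / qpoch (q ^ 4) (q ^ 4) j)" for j
  proof -
    have "qpoch_inf (- (q ^ 2)) (q ^ 2) = qpoch (- (q ^ 2)) (q ^ 2) j * qpoch_inf (- (q ^ (2 * j + 1 + 1))) (q ^ 2)"
    proof -
      have "- (q ^ 2) * (q ^ 2) ^ j = - (q ^ (2 * j + 1 + 1))"
        by (simp add: power_mult power2_eq_square)
      then show ?thesis
        using qpoch_inf_unfold[OF q2(2), of "- (q ^ 2)" j] by (simp only:)
    qed
    moreover have "qpoch (- (q ^ 2)) (q ^ 2) j * qpoch (q ^ 2) (q ^ 2) j = qpoch (q ^ 4) (q ^ 4) j"
      using qpoch_neg_mult[of "q ^ 2" "q ^ 2" j] by (simp add: power_mult[symmetric])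
    moreover have "qpoch (q ^ 2) (q ^ 2) j \<noteq> 0" "qpoch (q ^ 4) (q ^ 4) j \<noteq> 0"
      using qpoch_neq_0 q2 q4 by auto
    ultimately show ?thesis by (simp add: field_simps)
  qed
  then have "((\<lambda>j. (q ^ 4) ^ (j choose 2) * (q ^ B) ^ j / qpoch (q ^ 2) (q ^ 2) j *
          qpoch_inf (- (q ^ (2 * j + 1 + 1))) (q ^ 2)) has_sum
       (qpoch_inf (- (q ^ 2)) (q ^ 2) * qpoch_inf (- (q ^ B)) (q ^ 4))) UNIV"
    using has_sum_cmult_right[OF euler_has_sum[OF q4, of "q ^ B"]] by simp
  from qsummand_has_sum[OF q this] show ?thesis by simp
qed

section \<open>A recurrence and the uniqueness of its solutions\<close>

text \<open>The larger of two consecutive values grows by a factor of at most \<open>exp (c s)\<close> when \<open>s\<close>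
  decreases by one. The product of all these factors is finite, so a solution that vanishes at
  infinity vanishes everywhere.\<close>

lemma recurrence_null_solution:
  fixes e :: "nat \<Rightarrow> complex"
  assumes rec: "\<And>s. e s = (1 + a s) * e (Suc s) + b s * e (Suc (Suc s))"
    and c: "\<And>s. norm (a s) + norm (b s) \<le> c s" "summable c"
    and lim: "e \<longlonglongrightarrow> 0"
  shows "e s = 0"
proof -
  define M where "M = (\<lambda>s. max (norm (e s)) (norm (e (Suc s))))"
  have c0: "0 \<le> c s" for s
    using c(1)[of s] by (smt (verit) norm_ge_zero)
  have M0: "0 \<le> M s" for s by (simp add: M_def le_max_iff_disj)
  have M_step: "M s \<le> exp (c s) * M (Suc s)" for s
  proof -
    have "norm (e s) \<le> norm (1 + a s) * norm (e (Suc s)) + norm (b s) * norm (e (Suc (Suc s)))"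
      by (subst rec) (metis norm_mult norm_triangle_ineq)
    also have "\<dots> \<le> (1 + norm (a s)) * M (Suc s) + norm (b s) * M (Suc s)"
      using norm_triangle_ineq[of 1 "a s"] by (intro add_mono mult_mono) (auto simp: M_def)
    also have "\<dots> = (1 + (norm (a s) + norm (b s))) * M (Suc s)"
      by (simp add: algebra_simps)
    also have "\<dots> \<le> exp (c s) * M (Suc s)"
    proof (intro mult_right_mono M0)
      show "1 + (norm (a s) + norm (b s)) \<le> exp (c s)"
        using c(1)[of s] exp_ge_add_one_self[of "c s"] by linarith
    qed
    finally have "norm (e s) \<le> exp (c s) * M (Suc s)" .
    moreover have "norm (e (Suc s)) \<le> 1 * M (Suc s)" by (simp add: M_def)
    moreover have "1 * M (Suc s) \<le> exp (c s) * M (Suc s)"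
      using c0[of s] by (intro mult_right_mono M0) auto
    ultimately show ?thesis by (auto simp: M_def)
  qed
  have M_iter: "M s \<le> exp (\<Sum>k<m. c (k + s)) * M (m + s)" for m
  proof (induction m)
    case (Suc m)
    also have "exp (\<Sum>k<m. c (k + s)) * M (m + s) \<le> exp (\<Sum>k<m. c (k + s)) * (exp (c (m + s)) * M (Suc (m + s)))"
      by (intro mult_left_mono M_step) auto
    finally show ?case by (simp add: exp_add mult_ac)
  qed simp
  have sc: "summable (\<lambda>k. c (k + s))"
    using c(2) by (rule summable_ignore_initial_segment)
  have "M s \<le> exp (\<Sum>k. c (k + s)) * M (m + s)" for m
    using M_iter[of m] sum_le_suminf[OF sc, of "{..<m}"] c0
    by (smt (verit) M0 exp_le_cancel_iff finite_lessThan mult_right_mono)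
  moreover have "(\<lambda>m. exp (\<Sum>k. c (k + s)) * M (m + s)) \<longlonglongrightarrow> exp (\<Sum>k. c (k + s)) * 0"
  proof (intro tendsto_mult tendsto_const LIMSEQ_ignore_initial_segment)
    have "M \<longlonglongrightarrow> max (norm (0::complex)) (norm (0::complex))"
      unfolding M_def by (intro tendsto_max tendsto_norm lim LIMSEQ_Suc)
    then show "M \<longlonglongrightarrow> 0" by simp
  qed
  ultimately have "M s \<le> 0"
    by (intro LIMSEQ_le_const[of "\<lambda>m. exp (\<Sum>k. c (k + s)) * M (m + s)"]) auto
  then show ?thesis by (simp add: M_def)
qed

text \<open>Shifting the index in only one of two series turns a series that agrees with another one in sum,
  but not term by term, into one that agrees term by term.\<close>

lemma suminf_shift_first:
  fixes f g :: "nat \<Rightarrow> complex"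
  assumes "summable f" "summable g" "f 0 = 0"
  shows "(\<Sum>r. f r + g r) = (\<Sum>r. f (Suc r) + g r)"
proof -
  have "suminf f = (\<Sum>r. f (Suc r))"
    using suminf_split_head[OF assms(1)] assms(3) by simp
  moreover have "summable (\<lambda>r. f (Suc r))"
    using assms(1) by (subst summable_Suc_iff)
  ultimately show ?thesis
    using assms by (simp add: suminf_add[symmetric])
qed

text \<open>Up to the factor \<open>(-q;q)\<^sub>\<infinity> (-q;q^2)\<^sub>\<infinity>\<close>, these terms remain from the triple series when
  \<open>b = c = 2 s\<close>. The sums are values at \<open>x = q^(2s)\<close> of one function of \<open>x\<close>, and the recurrence below is
  its \<open>q\<close>-difference equation.\<close>

definition gg_term :: "complex \<Rightarrow> nat \<Rightarrow> nat \<Rightarrow> complex" where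
  "gg_term q s j = q ^ (2 * j ^ 2 + 2 * s * j) / (qpoch (q ^ 2) (q ^ 2) j * qpoch (- q) (q ^ 2) (j + s))"

section \<open>The well-poised companion series\<close>

definition wp_ratio :: "complex \<Rightarrow> nat \<Rightarrow> nat \<Rightarrow> complex" where
  "wp_ratio q s r = qpoch (- q) (q ^ 2) r * qpoch (q ^ 2) (q ^ 2) (r + s) /
     (qpoch (q ^ 2) (q ^ 2) r * qpoch (- q) (q ^ 2) (r + s + 1))"

text \<open>Up to a constant factor, \<open>alpha_term\<close> and \<open>beta_term\<close> are the terms of Andrews' series
  \<open>H\<^sub>2\<^sub>,\<^sub>1(a;x;q^2)\<close> and \<open>H\<^sub>2\<^sub>,\<^sub>2(a;x;q^2)\<close>, with \<open>a = -1/q\<close> and \<open>x = q^(2s+2)\<close>. At these \<open>x\<close> the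
  infinite products that occur in the terms reduce to the finite ones in \<open>wp_ratio\<close>.\<close>

definition alpha_term :: "complex \<Rightarrow> nat \<Rightarrow> nat \<Rightarrow> complex" where
  "alpha_term q s r =
     (-1) ^ r * q ^ (4 * r ^ 2 + 3 * r + 4 * r * s) * (1 - q ^ (2 * s + 4 * r + 2)) * wp_ratio q s r"

definition beta_term :: "complex \<Rightarrow> nat \<Rightarrow> nat \<Rightarrow> complex" where
  "beta_term q s r =
     (-1) ^ r * q ^ (4 * r ^ 2 + r + 4 * r * s) * (1 - q ^ (4 * s + 8 * r + 4)) * wp_ratio q s r"

context
  fixes q :: complex
  assumes q: "0 < norm q" "norm q < 1"
begin

lemma norm_q_square_less_1: "norm (q ^ 2) < 1"
  using q by (simp add: norm_power power_less_one_iff)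

lemma norm_minus_q_less_1: "norm (- q) < 1"
  using q by simp

lemma qpoch_bases_neq_0: "qpoch (- q) (q ^ 2) n \<noteq> 0" "qpoch (q ^ 2) (q ^ 2) n \<noteq> 0"
  using qpoch_neq_0 norm_q_square_less_1 norm_minus_q_less_1 by auto

lemma qpoch_steps:
  "qpoch (- q) (q ^ 2) (Suc n) = qpoch (- q) (q ^ 2) n * (1 + q ^ (2 * n + 1))"
  "qpoch (q ^ 2) (q ^ 2) (Suc n) = qpoch (q ^ 2) (q ^ 2) n * (1 - q ^ (2 * n + 2))"
  by (simp_all add: qpoch_Suc power_mult power2_eq_square)

lemma qpoch_factors_neq_0: "1 + q ^ (2 * n + 1) \<noteq> 0" "1 - q ^ (2 * n + 2) \<noteq> 0"
  using qpoch_bases_neq_0(1)[of "Suc n"] qpoch_bases_neq_0(2)[of "Suc n"] unfolding qpoch_steps by auto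

lemma norm_one_minus_power: "norm (1 - q ^ n) \<le> 2"
proof -
  have "norm (1 - q ^ n) \<le> norm (1 :: complex) + norm (q ^ n)"
    by (rule norm_triangle_ineq4)
  also have "\<dots> \<le> 2"
    using q by (simp add: norm_power power_le_one)
  finally show ?thesis .
qed

lemma gg_term_bound:
  obtains C where "\<And>s j. norm (gg_term q s j) \<le> C * norm q ^ j"
proof -
  obtain K where K: "K > 0" "\<And>n. inverse (norm (qpoch (q ^ 2) (q ^ 2) n)) \<le> K"
    using qpoch_bounds[OF norm_q_square_less_1 norm_q_square_less_1] by metis
  obtain L where L: "L > 0" "\<And>n. inverse (norm (qpoch (- q) (q ^ 2) n)) \<le> L"
    using qpoch_bounds[OF norm_minus_q_less_1 norm_q_square_less_1] by metis
  have "norm (gg_term q s j) \<le> K * L * norm q ^ j" for s j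
  proof -
    have "norm (gg_term q s j) = inverse (norm (qpoch (q ^ 2) (q ^ 2) j)) *
      inverse (norm (qpoch (- q) (q ^ 2) (j + s))) * norm q ^ (2 * j ^ 2 + 2 * s * j)"
      by (simp add: gg_term_def norm_divide norm_mult norm_power norm_inverse divide_inverse)
    also have "\<dots> \<le> K * L * norm q ^ j"
    proof (intro mult_mono K(2) L(2) power_decreasing)
      show "j \<le> 2 * j ^ 2 + 2 * s * j"
        by (cases j) (auto simp: power2_eq_square)
    qed (use K L q in auto)
    finally show ?thesis .
  qed
  then show ?thesis by (rule that)
qed

lemma wp_ratio_bound:
  obtains C where "C > 0" "\<And>s r. norm (wp_ratio q s r) \<le> C"
proof -
  obtain K where K: "K > 0" "\<And>n. norm (qpoch (q ^ 2) (q ^ 2) n) \<le> K"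
      "\<And>n. inverse (norm (qpoch (q ^ 2) (q ^ 2) n)) \<le> K"
    using qpoch_bounds[OF norm_q_square_less_1 norm_q_square_less_1] by metis
  obtain L where L: "L > 0" "\<And>n. norm (qpoch (- q) (q ^ 2) n) \<le> L"
      "\<And>n. inverse (norm (qpoch (- q) (q ^ 2) n)) \<le> L"
    using qpoch_bounds[OF norm_minus_q_less_1 norm_q_square_less_1] by metis
  have "norm (wp_ratio q s r) \<le> (L * K) * (K * L)" for s r
  proof -
    have "norm (wp_ratio q s r) =
      (norm (qpoch (- q) (q ^ 2) r) * norm (qpoch (q ^ 2) (q ^ 2) (r + s))) *
      (inverse (norm (qpoch (q ^ 2) (q ^ 2) r)) * inverse (norm (qpoch (- q) (q ^ 2) (r + s + 1))))"
      by (simp add: wp_ratio_def norm_divide norm_mult norm_inverse divide_inverse)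
    also have "\<dots> \<le> (L * K) * (K * L)"
      by (intro mult_mono K L) (use K(1) L(1) in auto)
    finally show ?thesis .
  qed
  then show ?thesis using that[of "(L * K) * (K * L)"] K(1) L(1) by simp
qed

lemma wp_term_bound:
  obtains C where "\<And>s r e w. r \<le> e \<Longrightarrow> norm w \<le> 2 \<Longrightarrow>
    norm ((-1) ^ r * q ^ e * w * wp_ratio q s r) \<le> C * norm q ^ r"
proof -
  obtain C where C: "C > 0" "\<And>s r. norm (wp_ratio q s r) \<le> C"
    using wp_ratio_bound by blast
  have "norm ((-1) ^ r * q ^ e * w * wp_ratio q s r) \<le> norm q ^ r * 2 * C" if "r \<le> e" "norm w \<le> 2" for s r e w
    unfolding norm_mult norm_power using C q that
    by (auto intro!: mult_mono power_decreasing)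
  then show ?thesis by (intro that[of "2 * C"]) (simp add: mult_ac)
qed

lemma summable_geometric_bound:
  assumes "\<And>r. norm (f r) \<le> C * norm q ^ r"
  shows "summable (\<lambda>r. norm (f r))" "summable (f :: nat \<Rightarrow> complex)"
proof -
  have "summable (\<lambda>r. C * norm q ^ r)"
    by (intro summable_mult summable_geometric) (use q in auto)
  then show "summable (\<lambda>r. norm (f r))"
    by (rule summable_comparison_test[rotated]) (use assms in auto)
  then show "summable f" by (rule summable_norm_cancel)
qed

lemma summable_wp_term:
  assumes "\<And>r. r \<le> e r" "\<And>r. norm (w r) \<le> 2"
  shows "summable (\<lambda>r. (-1) ^ r * q ^ e r * w r * wp_ratio q s r)"
proof -
  obtain C where C: "\<And>s r e w. r \<le> e \<Longrightarrow> norm w \<le> 2 \<Longrightarrow>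
    norm ((-1) ^ r * q ^ e * w * wp_ratio q s r) \<le> C * norm q ^ r"
    using wp_term_bound by blast
  show ?thesis
    by (rule summable_geometric_bound(2)[of _ C]) (rule C[OF assms])
qed

lemma summable_gg_term: "summable (\<lambda>j. norm (gg_term q s j))" "summable (gg_term q s)"
  using gg_term_bound summable_geometric_bound by metis+

lemma summable_alpha_term: "summable (alpha_term q s)"
  unfolding alpha_term_def by (rule summable_wp_term[OF _ norm_one_minus_power]) simp

lemma summable_beta_term: "summable (beta_term q s)"
  unfolding beta_term_def by (rule summable_wp_term[OF _ norm_one_minus_power]) simp

text \<open>The combination \<open>d\<close> of the terms for \<open>s\<close> and \<open>s + 1\<close> contains the factor \<open>1 - q^(2j)\<close>, which kills
  the first term and lowers the index of \<open>(q^2;q^2)\<^sub>j\<close>. Shifting \<open>j\<close> by one therefore produces the terms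
  for \<open>s + 2\<close>.\<close>

lemma gg_recurrence:
  "suminf (gg_term q s) = (1 + q ^ (2 * s + 1)) * suminf (gg_term q (Suc s))
     + q ^ (2 * s + 2) * suminf (gg_term q (Suc (Suc s)))"
proof -
  define d where "d = (\<lambda>j. gg_term q s j - (1 + q ^ (2 * s + 1)) * gg_term q (Suc s) j)"
  have d: "d j = q ^ (2 * j ^ 2 + 2 * s * j) * (1 - q ^ (2 * j)) /
      (qpoch (q ^ 2) (q ^ 2) j * qpoch (- q) (q ^ 2) (Suc (j + s)))" for j
  proof -
    have pw: "q ^ (2 * j ^ 2 + 2 * Suc s * j) = q ^ (2 * j ^ 2 + 2 * s * j) * q ^ (2 * j)"
      "q ^ (2 * (j + s) + 1) = q ^ (2 * j) * q ^ (2 * s + 1)"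
      by (simp_all add: power_add[symmetric] algebra_simps)
    show ?thesis
      unfolding d_def gg_term_def pw add_Suc_right qpoch_steps
      using qpoch_bases_neq_0(1)[of "j + s"] qpoch_bases_neq_0(2)[of j] qpoch_factors_neq_0(1)[of "j + s", unfolded pw]
      by (simp add: divide_simps) (simp add: algebra_simps)
  qed
  have d_Suc: "d (Suc j) = q ^ (2 * s + 2) * gg_term q (Suc (Suc s)) j" for j
  proof -
    have pw: "q ^ (2 * Suc j ^ 2 + 2 * s * Suc j) = q ^ (2 * s + 2) * q ^ (2 * j ^ 2 + 2 * Suc (Suc s) * j)"
      unfolding power_add[symmetric]
      by (rule arg_cong[where f = "\<lambda>n. q ^ n"]) (simp add: power2_eq_square algebra_simps)
    have "2 * Suc j = 2 * j + 2" by simp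
    then show ?thesis
      unfolding d gg_term_def pw qpoch_steps(2)
      using qpoch_factors_neq_0(2)[of j] by simp
  qed
  have "summable d"
    unfolding d_def by (intro summable_diff summable_mult summable_gg_term)
  moreover have "d 0 = 0"
    by (simp add: d)
  ultimately have "suminf d = (\<Sum>j. d (Suc j))"
    using suminf_split_head by force
  also have "\<dots> = q ^ (2 * s + 2) * suminf (gg_term q (Suc (Suc s)))"
    unfolding d_Suc by (intro suminf_mult summable_gg_term)
  also have "suminf d = suminf (gg_term q s) - (1 + q ^ (2 * s + 1)) * suminf (gg_term q (Suc s))"
    unfolding d_def suminf_mult[OF summable_gg_term(2), symmetric]
    by (intro suminf_diff[symmetric] summable_gg_term summable_mult)
  finally show ?thesis by (simp add: algebra_simps)
qed

text \<open>The next two rules bring \<open>wp_ratio q s (r + 1)\<close> and \<open>wp_ratio q s r\<close> to the common ratio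
  \<open>wp_ratio q (s + 1) r\<close>. They make the two recurrences below identities between polynomials.\<close>

lemma wp_ratio_Suc_right:
  "wp_ratio q s (Suc r) * (1 - q ^ (2 * r + 2)) = wp_ratio q (Suc s) r * (1 + q ^ (2 * r + 1))"
  using qpoch_bases_neq_0 qpoch_factors_neq_0(2)[of r]
  by (simp add: wp_ratio_def qpoch_steps(1)[of r] qpoch_steps(2)[of r] field_simps)

lemma wp_ratio_Suc_left:
  "wp_ratio q s r * (1 - q ^ (2 * r + 2 * s + 2)) = wp_ratio q (Suc s) r * (1 + q ^ (2 * r + 2 * s + 3))"
proof -
  define G where "G = 1 + q ^ (2 * Suc (r + s) + 1)"
  have G: "G \<noteq> 0" "1 + q ^ (2 * r + 2 * s + 3) = G"
    using qpoch_factors_neq_0(1)[of "Suc (r + s)"] by (simp_all add: G_def numeral_3_eq_3 algebra_simps)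
  have idx: "r + s + 1 = Suc (r + s)" "Suc (r + s) + 1 = Suc (Suc (r + s))" "r + Suc s = Suc (r + s)"
    "2 * r + 2 * s + 2 = 2 * (r + s) + 2" by simp_all
  have "x * y / (v * w) * f = x * (y * f) / (v * (w * G)) * G" for x y v w f
    using G(1) by simp
  then show ?thesis
    unfolding wp_ratio_def G(2) idx qpoch_steps(1)[of "Suc (r + s)", folded G_def] qpoch_steps(2)[of "r + s"] .
qed

text \<open>With \<open>X = q^(2r)\<close> and \<open>S = q^(2s+2)\<close>, the polynomial factors of the two terms differ by
  \<open>(1 - X^4 S^2) - X (1 - X^2 S) = (1 - X) + X^3 S (1 - X S)\<close>. The factor \<open>1 - X\<close> is absorbed by
  \<open>(q^2;q^2)\<^sub>r\<close> after an index shift, and \<open>1 - X S\<close> is absorbed by \<open>(q^2;q^2)\<^sub>r\<^sub>+\<^sub>s\<close>. Both parts then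
  carry \<open>wp_ratio q (s + 1) r\<close> and add up to the term of the other series.\<close>

lemma beta_sum_relation:
  "suminf (beta_term q s) = suminf (alpha_term q s) + q ^ (2 * s + 2) * suminf (alpha_term q (Suc s))"
proof -
  define f where "f = (\<lambda>r. (-1) ^ r * q ^ (4 * r ^ 2 + r + 4 * r * s) * (1 - q ^ (2 * r)) * wp_ratio q s r)"
  define g where "g = (\<lambda>r. (-1) ^ r * q ^ (4 * r ^ 2 + 7 * r + 4 * r * s + 2 * s + 2) *
    (1 - q ^ (2 * r + 2 * s + 2)) * wp_ratio q s r)"
  have sm: "summable f" "summable g"
    unfolding f_def g_def by (rule summable_wp_term[OF _ norm_one_minus_power], simp)+
  have fg: "beta_term q s r - alpha_term q s r = f r + g r" for r
  proof -
    define E X S where "E = q ^ (4 * r ^ 2 + r + 4 * r * s)" and "X = q ^ (2 * r)" and "S = q ^ (2 * s + 2)"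
    have pw: "q ^ (4 * r ^ 2 + 3 * r + 4 * r * s) = E * X"
      "q ^ (4 * r ^ 2 + 7 * r + 4 * r * s + 2 * s + 2) = E * X ^ 3 * S"
      "q ^ (2 * s + 4 * r + 2) = X ^ 2 * S"
      "q ^ (4 * s + 8 * r + 4) = X ^ 4 * S ^ 2"
      "q ^ (2 * r + 2 * s + 2) = X * S"
      unfolding E_def X_def S_def power_mult[symmetric] power_add[symmetric]
      by (rule arg_cong[where f = "\<lambda>n. q ^ n"], simp)+
    show ?thesis
      unfolding beta_term_def alpha_term_def f_def g_def pw E_def[symmetric] X_def[symmetric] by algebra
  qed
  have fg_Suc: "f (Suc r) + g r = q ^ (2 * s + 2) * alpha_term q (Suc s) r" for r
  proof -
    define E X S where "E = q ^ (4 * r ^ 2 + r + 4 * r * s)" and "X = q ^ (2 * r)" and "S = q ^ (2 * s)"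
    have idx: "2 * Suc r = 2 * r + 2" by simp
    define W where "W = wp_ratio q (Suc s) r"
    have pw: "q ^ (4 * Suc r ^ 2 + Suc r + 4 * Suc r * s) = E * X ^ 4 * S ^ 2 * q ^ 5"
      "q ^ (4 * r ^ 2 + 7 * r + 4 * r * s + 2 * s + 2) = E * X ^ 3 * S * q ^ 2"
      "q ^ (4 * r ^ 2 + 3 * r + 4 * r * Suc s) = E * X ^ 3"
      "q ^ (2 * Suc s + 4 * r + 2) = X ^ 2 * S * q ^ 4"
      "q ^ (2 * s + 2) = S * q ^ 2"
      "q ^ (2 * r + 1) = X * q"
      "q ^ (2 * r + 2 * s + 3) = X * S * q ^ 3"
      unfolding E_def X_def S_def power_mult[symmetric] power_add[symmetric] power_Suc2[symmetric]
      by (rule arg_cong[where f = "\<lambda>n. q ^ n"], simp add: power2_eq_square algebra_simps)+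
    have f_Suc: "f (Suc r) = - ((-1) ^ r) * (E * X ^ 4 * S ^ 2 * q ^ 5) * (W * (1 + X * q))"
      unfolding f_def W_def wp_ratio_Suc_right[of s r, unfolded pw, symmetric] pw idx
      by (simp add: mult_ac)
    have g_eq: "g r = (-1) ^ r * (E * X ^ 3 * S * q ^ 2) * (W * (1 + X * S * q ^ 3))"
      using wp_ratio_Suc_left[of s r] unfolding g_def pw W_def by (simp add: mult_ac)
    show ?thesis
      unfolding f_Suc g_eq alpha_term_def pw W_def[symmetric] by algebra
  qed
  have "suminf (beta_term q s) - suminf (alpha_term q s) = (\<Sum>r. f r + g r)"
    by (subst suminf_diff[OF summable_beta_term summable_alpha_term]) (simp add: fg)
  also have "\<dots> = (\<Sum>r. f (Suc r) + g r)"
    by (rule suminf_shift_first[OF sm]) (simp add: f_def)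
  also have "\<dots> = q ^ (2 * s + 2) * suminf (alpha_term q (Suc s))"
    unfolding fg_Suc by (intro suminf_mult summable_alpha_term)
  finally show ?thesis by (simp add: algebra_simps)
qed

text \<open>The method is that of \<open>beta_sum_relation\<close>, now with the splitting
  \<open>1 - X^2 S = (1 - X) + X (1 - X S)\<close>.\<close>

lemma alpha_sum_relation:
  "suminf (alpha_term q s) = suminf (beta_term q (Suc s)) + q ^ (2 * s + 3) * suminf (alpha_term q (Suc s))"
proof -
  define f where "f = (\<lambda>r. (-1) ^ r * q ^ (4 * r ^ 2 + 3 * r + 4 * r * s) * (1 - q ^ (2 * r)) * wp_ratio q s r)"
  define g where "g = (\<lambda>r. (-1) ^ r * q ^ (4 * r ^ 2 + 5 * r + 4 * r * s) *
    (1 - q ^ (2 * r + 2 * s + 2)) * wp_ratio q s r)"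
  have sm: "summable f" "summable g"
    unfolding f_def g_def by (rule summable_wp_term[OF _ norm_one_minus_power], simp)+
  have fg: "alpha_term q s r = f r + g r" for r
  proof -
    define E X S where "E = q ^ (4 * r ^ 2 + 3 * r + 4 * r * s)" and "X = q ^ (2 * r)" and "S = q ^ (2 * s + 2)"
    have pw: "q ^ (4 * r ^ 2 + 5 * r + 4 * r * s) = E * X"
      "q ^ (2 * s + 4 * r + 2) = X ^ 2 * S"
      "q ^ (2 * r + 2 * s + 2) = X * S"
      unfolding E_def X_def S_def power_mult[symmetric] power_add[symmetric]
      by (rule arg_cong[where f = "\<lambda>n. q ^ n"], simp)+
    show ?thesis
      unfolding alpha_term_def f_def g_def pw E_def[symmetric] X_def[symmetric] by algebra
  qed
  have fg_Suc: "f (Suc r) + g r = beta_term q (Suc s) r + q ^ (2 * s + 3) * alpha_term q (Suc s) r" for r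
  proof -
    define E X S where "E = q ^ (4 * r ^ 2 + r + 4 * r * s)" and "X = q ^ (2 * r)" and "S = q ^ (2 * s)"
    have idx: "2 * Suc r = 2 * r + 2" by simp
    define W where "W = wp_ratio q (Suc s) r"
    have pw: "q ^ (4 * Suc r ^ 2 + 3 * Suc r + 4 * Suc r * s) = E * X ^ 5 * S ^ 2 * q ^ 7"
      "q ^ (4 * r ^ 2 + 5 * r + 4 * r * s) = E * X ^ 2"
      "q ^ (4 * r ^ 2 + r + 4 * r * Suc s) = E * X ^ 2"
      "q ^ (4 * r ^ 2 + 3 * r + 4 * r * Suc s) = E * X ^ 3"
      "q ^ (2 * Suc s + 4 * r + 2) = X ^ 2 * S * q ^ 4"
      "q ^ (4 * Suc s + 8 * r + 4) = X ^ 4 * S ^ 2 * q ^ 8"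
      "q ^ (2 * s + 3) = S * q ^ 3"
      "q ^ (2 * r + 1) = X * q"
      "q ^ (2 * r + 2 * s + 3) = X * S * q ^ 3"
      unfolding E_def X_def S_def power_mult[symmetric] power_add[symmetric] power_Suc2[symmetric]
      by (rule arg_cong[where f = "\<lambda>n. q ^ n"], simp add: power2_eq_square algebra_simps)+
    have f_Suc: "f (Suc r) = - ((-1) ^ r) * (E * X ^ 5 * S ^ 2 * q ^ 7) * (W * (1 + X * q))"
      unfolding f_def W_def wp_ratio_Suc_right[of s r, unfolded pw, symmetric] pw idx
      by (simp add: mult_ac)
    have g_eq: "g r = (-1) ^ r * (E * X ^ 2) * (W * (1 + X * S * q ^ 3))"
      using wp_ratio_Suc_left[of s r] unfolding g_def pw W_def by (simp add: mult_ac)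
    show ?thesis
      unfolding f_Suc g_eq alpha_term_def beta_term_def pw W_def[symmetric] by algebra
  qed
  have "suminf (alpha_term q s) = (\<Sum>r. f r + g r)"
    by (rule suminf_cong) (rule fg)
  also have "\<dots> = (\<Sum>r. f (Suc r) + g r)"
    by (rule suminf_shift_first[OF sm]) (simp add: f_def)
  also have "\<dots> = suminf (beta_term q (Suc s)) + (\<Sum>r. q ^ (2 * s + 3) * alpha_term q (Suc s) r)"
    unfolding fg_Suc by (intro suminf_add[symmetric] summable_mult summable_alpha_term summable_beta_term)
  finally show ?thesis
    by (simp only: suminf_mult[OF summable_alpha_term])
qed

section \<open>Identification of the two solutions\<close>

lemma tendsto_power_zero_of_ge:
  assumes "\<And>s. s \<le> e s"
  shows "(\<lambda>s. q ^ e s) \<longlonglongrightarrow> 0"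
proof -
  have "(\<lambda>s. norm q ^ s) \<longlonglongrightarrow> 0"
    using q by (intro LIMSEQ_realpow_zero) auto
  then show ?thesis
    by (rule Lim_null_comparison[rotated])
       (use q assms in \<open>auto simp: norm_power intro!: always_eventually power_decreasing\<close>)
qed

text \<open>In the series considered here the power of \<open>q\<close> in term \<open>r\<close> contains a multiple of \<open>r * s\<close>, so that
  for large \<open>s\<close> only the first term survives.\<close>

lemma suminf_tendsto_first_term:
  fixes f :: "nat \<Rightarrow> nat \<Rightarrow> complex"
  assumes bound: "\<And>s r. norm (f s r) \<le> C * norm q ^ r"
    and first: "(\<lambda>s. f s 0) \<longlonglongrightarrow> L"
    and rest: "\<And>r. (\<lambda>s. f s (Suc r)) \<longlonglongrightarrow> 0"
  shows "(\<lambda>s. suminf (f s)) \<longlonglongrightarrow> L"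
proof -
  define g where "g = (\<lambda>r::nat. if r = 0 then L else 0)"
  have C: "(\<lambda>r. C * norm q ^ r) summable_on UNIV"
    by (intro summable_on_cmult_right norm_summable_imp_summable_on) (use q in \<open>simp add: norm_power\<close>)
  have "summable (\<lambda>r. norm (f s r))" "summable (f s)" for s
    using summable_geometric_bound[OF bound] by auto
  then have "(f s has_sum suminf (f s)) UNIV" for s
    by (intro norm_summable_imp_has_sum summable_sums) auto
  moreover have "(\<lambda>s. f s r) \<longlonglongrightarrow> g r" for r
    using first rest by (cases r) (auto simp: g_def)
  ultimately have "(\<lambda>s. suminf (f s)) \<longlonglongrightarrow> infsum g UNIV"
    by (intro infsum_dominated_convergence(2)[of UNIV f _ "\<lambda>s. suminf (f s)", OF _ C] bound)
  moreover have "infsum g UNIV = L"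
    by (rule infsumI, rule has_sum_finite_neutralI[of "{0}"]) (auto simp: g_def)
  ultimately show ?thesis by simp
qed

lemma gg_tendsto: "(\<lambda>s. suminf (gg_term q s)) \<longlonglongrightarrow> inverse (qpoch_inf (- q) (q ^ 2))"
proof -
  obtain C where C: "\<And>s j. norm (gg_term q s j) \<le> C * norm q ^ j"
    using gg_term_bound by blast
  have P0: "qpoch_inf (- q) (q ^ 2) \<noteq> 0"
    by (intro qpoch_inf_neq_0 norm_minus_q_less_1 norm_q_square_less_1)
  have P: "(\<lambda>s. qpoch (- q) (q ^ 2) (j + s)) \<longlonglongrightarrow> qpoch_inf (- q) (q ^ 2)" for j
    using LIMSEQ_ignore_initial_segment[OF qpoch_tendsto[OF norm_q_square_less_1], of "- q" j]
    by (simp add: add.commute)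
  show ?thesis
  proof (rule suminf_tendsto_first_term[OF C])
    show "(\<lambda>s. gg_term q s 0) \<longlonglongrightarrow> inverse (qpoch_inf (- q) (q ^ 2))"
      using tendsto_inverse[OF P[of 0] P0] by (simp add: gg_term_def divide_inverse)
    fix j
    have "(\<lambda>s. q ^ (2 * Suc j ^ 2 + 2 * s * Suc j) / (qpoch (q ^ 2) (q ^ 2) (Suc j) * qpoch (- q) (q ^ 2) (Suc j + s)))
      \<longlonglongrightarrow> 0 / (qpoch (q ^ 2) (q ^ 2) (Suc j) * qpoch_inf (- q) (q ^ 2))"
      by (intro tendsto_intros P tendsto_power_zero_of_ge) (use P0 qpoch_neq_0[OF norm_q_square_less_1 norm_q_square_less_1] in auto)
    then show "(\<lambda>s. gg_term q s (Suc j)) \<longlonglongrightarrow> 0"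
      by (simp add: gg_term_def)
  qed
qed

lemma alpha_tendsto:
  "(\<lambda>s. suminf (alpha_term q s)) \<longlonglongrightarrow> qpoch_inf (q ^ 2) (q ^ 2) / qpoch_inf (- q) (q ^ 2)"
proof -
  obtain C where C: "\<And>s r e w. r \<le> e \<Longrightarrow> norm w \<le> 2 \<Longrightarrow>
    norm ((-1) ^ r * q ^ e * w * wp_ratio q s r) \<le> C * norm q ^ r"
    using wp_term_bound by blast
  have P0: "qpoch_inf (- q) (q ^ 2) \<noteq> 0"
    by (intro qpoch_inf_neq_0 norm_minus_q_less_1 norm_q_square_less_1)
  have lim: "(\<lambda>s. qpoch a (q ^ 2) (j + s)) \<longlonglongrightarrow> qpoch_inf a (q ^ 2)" for a j
    using LIMSEQ_ignore_initial_segment[OF qpoch_tendsto[OF norm_q_square_less_1], of a j]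
    by (simp add: add.commute)
  have W: "(\<lambda>s. wp_ratio q s r) \<longlonglongrightarrow> qpoch (- q) (q ^ 2) r * qpoch_inf (q ^ 2) (q ^ 2) /
     (qpoch (q ^ 2) (q ^ 2) r * qpoch_inf (- q) (q ^ 2))" for r
    unfolding wp_ratio_def
    using lim[of "- q" "r + 1"] P0 qpoch_neq_0[OF norm_q_square_less_1 norm_q_square_less_1] by (intro tendsto_intros lim) (auto simp: add_ac)
  have one: "(\<lambda>s. 1 - q ^ (2 * s + 4 * r + 2)) \<longlonglongrightarrow> 1 - 0" for r
    by (intro tendsto_intros tendsto_power_zero_of_ge) simp
  show ?thesis
  proof (rule suminf_tendsto_first_term)
    show "norm (alpha_term q s r) \<le> C * norm q ^ r" for s r
      unfolding alpha_term_def by (intro C norm_one_minus_power) simp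
    show "(\<lambda>s. alpha_term q s 0) \<longlonglongrightarrow> qpoch_inf (q ^ 2) (q ^ 2) / qpoch_inf (- q) (q ^ 2)"
      using tendsto_mult[OF one[of 0] W[of 0]] by (simp add: alpha_term_def)
    fix r
    have "(\<lambda>s. q ^ (4 * Suc r ^ 2 + 3 * Suc r + 4 * Suc r * s)) \<longlonglongrightarrow> 0"
      by (intro tendsto_power_zero_of_ge trans_le_add2) simp
    from tendsto_mult[OF tendsto_mult[OF tendsto_mult[OF tendsto_const[of "(-1) ^ Suc r"] this] one[of "Suc r"]] W[of "Suc r"]]
    show "(\<lambda>s. alpha_term q s (Suc r)) \<longlonglongrightarrow> 0"
      unfolding alpha_term_def by simp
  qed
qed

text \<open>Eliminating the \<open>beta\<close> series, the sums of \<open>alpha_term q s\<close> satisfy the recurrence of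
  \<open>gg_recurrence\<close> at \<open>s + 1\<close>. Both sides have the same limit as \<open>s\<close> grows, hence they are equal.\<close>

lemma alpha_sum_eq_gg_sum:
  "suminf (alpha_term q s) = qpoch_inf (q ^ 2) (q ^ 2) * suminf (gg_term q (Suc s))"
proof -
  define c where "c = qpoch_inf (q ^ 2) (q ^ 2)"
  define e where "e = (\<lambda>s. suminf (alpha_term q s) - c * suminf (gg_term q (Suc s)))"
  have "e s = 0"
  proof (rule recurrence_null_solution[where a = "\<lambda>s. q ^ (2 * s + 3)" and b = "\<lambda>s. q ^ (2 * s + 4)" and c = "\<lambda>s. 2 * norm q ^ s"])
    fix s
    have idx: "2 * Suc s + 2 = 2 * s + 4" "2 * Suc s + 1 = 2 * s + 3" by simp_all
    show "e s = (1 + q ^ (2 * s + 3)) * e (Suc s) + q ^ (2 * s + 4) * e (Suc (Suc s))"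
      unfolding e_def gg_recurrence[of "Suc s"] alpha_sum_relation[of s] beta_sum_relation[of "Suc s"] idx
      by (simp add: algebra_simps)
    have "norm q ^ (2 * s + 3) \<le> norm q ^ s" "norm q ^ (2 * s + 4) \<le> norm q ^ s"
      using q by (auto intro!: power_decreasing)
    then show "norm (q ^ (2 * s + 3)) + norm (q ^ (2 * s + 4)) \<le> 2 * norm q ^ s"
      unfolding norm_power by linarith
  next
    show "summable (\<lambda>s. 2 * norm q ^ s)"
      using q by (intro summable_mult summable_geometric) auto
    have "e \<longlonglongrightarrow> c / qpoch_inf (- q) (q ^ 2) - c * inverse (qpoch_inf (- q) (q ^ 2))"
      unfolding e_def c_def by (intro tendsto_intros alpha_tendsto LIMSEQ_Suc gg_tendsto)
    then show "e \<longlonglongrightarrow> 0" by (simp add: divide_inverse)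
  qed
  then show ?thesis by (simp add: e_def c_def)
qed

text \<open>The case \<open>s = 0\<close> of the Goellnitz-Gordon series lies one step outside of \<open>alpha_sum_eq_gg_sum\<close>; one
  step of the recurrence reaches it.\<close>

lemma gg_sum_0_eq_beta_alpha:
  "qpoch_inf (q ^ 2) (q ^ 2) * suminf (gg_term q 0) = suminf (beta_term q 0) + q * suminf (alpha_term q 0)"
  unfolding gg_recurrence[of 0] beta_sum_relation[of 0] alpha_sum_eq_gg_sum
  by (simp add: algebra_simps numeral_2_eq_2)

text \<open>The triple product with base \<open>q^8\<close> and \<open>z = q^m\<close>, where the terms \<open>n\<close> and \<open>- 1 - n\<close> are
  collected.\<close>

lemma theta_sums:
  assumes "m \<le> 8"
  shows "(\<lambda>n. (-1) ^ n * q ^ (8 * (n choose 2) + m * n) * (1 - q ^ ((16 - 2 * m) * n + (8 - m)))) sums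
    (qpoch_inf (q ^ m) (q ^ 8) * qpoch_inf (q ^ (8 - m)) (q ^ 8) * qpoch_inf (q ^ 8) (q ^ 8))"
proof -
  have q8: "0 < norm (q ^ 8)" "norm (q ^ 8) < 1"
    using q by (auto simp: norm_power power_less_one_iff)
  have q0: "q \<noteq> 0" using q by auto
  define T where "T = theta_term (q ^ m) (q ^ 8)"
  have 1: "T (int n) = (-1) ^ n * q ^ (8 * (n choose 2) + m * n)" for n
  proof -
    have "(- (q ^ m)) ^ n = (-1) ^ n * q ^ (m * n)"
      by (subst power_minus) (simp add: power_mult)
    then show ?thesis
      by (simp add: T_def theta_term_def tri_int power_mult[symmetric] power_add)
  qed
  have 2: "T (- 1 - int n) = - ((-1) ^ n * q ^ (8 * (n choose 2) + m * n) * q ^ ((16 - 2 * m) * n + (8 - m)))" for n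
  proof -
    have sgn: "(- (q ^ m)) ^ Suc n = (-1) ^ Suc n * q ^ (m * Suc n)"
      by (subst power_minus) (simp only: power_mult)
    have e: "int (n choose 2) + 2 * int n + 1 = int ((n choose 2) + 2 * n + 1)" "- 1 - int n = - int (Suc n)" by simp_all
    have "T (- 1 - int n) = (q ^ 8) ^ ((n choose 2) + 2 * n + 1) / (- (q ^ m)) ^ Suc n"
      unfolding T_def theta_term_def tri_neg unfolding e power_int_minus power_int_of_nat divide_inverse ..
    moreover have "(q ^ 8) ^ ((n choose 2) + 2 * n + 1) =
       q ^ (8 * (n choose 2) + m * n) * q ^ ((16 - 2 * m) * n + (8 - m)) * q ^ (m * Suc n)"
      unfolding power_mult[symmetric] power_add[symmetric]
    proof (rule arg_cong[where f = "\<lambda>n. q ^ n"])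
      obtain l where "8 = m + l" using assms le_Suc_ex by blast
      then have "l = 8 - m" "16 - 2 * m = 2 * l" by auto
      with \<open>8 = m + l\<close> show "8 * ((n choose 2) + 2 * n + 1) =
         8 * (n choose 2) + m * n + ((16 - 2 * m) * n + (8 - m)) + m * Suc n"
        by (smt (verit) add_mult_distrib mult_Suc_right mult.commute mult_2 add.assoc add.commute mult_numeral_1_right nat_mult_1 distrib_left)
    qed
    moreover have "x * y * z / ((-1) ^ Suc n * z) = - ((-1) ^ n * x * y)" if "z \<noteq> 0" for x y z :: complex
      using that by (cases "even n") auto
    ultimately show ?thesis
      unfolding sgn using q0 by (simp only: power_eq_0_iff not_False_eq_True simp_thms)
  qed
  have "(T has_sum qpoch_inf (q ^ m) (q ^ 8) * qpoch_inf (q ^ 8 / q ^ m) (q ^ 8) * qpoch_inf (q ^ 8) (q ^ 8)) UNIV"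
    unfolding T_def by (intro jacobi_triple_product q8) (use q0 in auto)
  from has_sum_imp_sums[OF has_sum_int_fold[OF this]]
  have "(\<lambda>n. T (int n) + T (- 1 - int n)) sums
    (qpoch_inf (q ^ m) (q ^ 8) * qpoch_inf (q ^ (8 - m)) (q ^ 8) * qpoch_inf (q ^ 8) (q ^ 8))"
    using assms q0 by (simp add: power_diff)
  then show ?thesis
    unfolding 1 2 by (simp add: algebra_simps)
qed

text \<open>At \<open>s = 0\<close> the ratio \<open>wp_ratio\<close> is \<open>1 / (1 + x)\<close> with \<open>x = q^(2r+1)\<close>, and
  \<open>(1 - x^4) + x (1 - x^2) = (1 + x) (1 - x^3)\<close> cancels it. What remains is a theta series.\<close>

lemma gg_theta_0:
  "qpoch_inf (q ^ 2) (q ^ 2) * suminf (gg_term q 0) =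
     qpoch_inf (q ^ 5) (q ^ 8) * qpoch_inf (q ^ 3) (q ^ 8) * qpoch_inf (q ^ 8) (q ^ 8)"
proof -
  have eq: "beta_term q 0 r + q * alpha_term q 0 r =
     (-1) ^ r * q ^ (8 * (r choose 2) + 5 * r) * (1 - q ^ ((16 - 2 * 5) * r + (8 - 5)))" for r
  proof -
    define x where "x = q ^ (2 * r + 1)"
    define E where "E = q ^ (4 * r ^ 2 + r)"
    have W: "wp_ratio q 0 r * (1 + x) = 1"
      using qpoch_bases_neq_0 qpoch_factors_neq_0(1)[of r]
      by (simp add: wp_ratio_def x_def qpoch_steps(1)[of r, simplified])
    have pw: "q ^ (4 * r ^ 2 + r + 4 * r * 0) = E" "q * q ^ (4 * r ^ 2 + 3 * r + 4 * r * 0) = E * x"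
       "q ^ (4 * 0 + 8 * r + 4) = x ^ 4" "q ^ (2 * 0 + 4 * r + 2) = x ^ 2"
       "q ^ (8 * (r choose 2) + 5 * r) = E" "q ^ ((16 - 2 * 5) * r + (8 - 5)) = x ^ 3"
      unfolding E_def x_def power_mult[symmetric] power_add[symmetric] power_Suc[symmetric] eight_choose_two[symmetric]
      by (rule arg_cong[where f = "\<lambda>n. q ^ n"], simp)+
    have "beta_term q 0 r + q * alpha_term q 0 r = (-1) ^ r * E * (1 - x ^ 4) * wp_ratio q 0 r +
        (-1) ^ r * (E * x) * (1 - x ^ 2) * wp_ratio q 0 r"
      unfolding beta_term_def alpha_term_def pw(2)[symmetric] pw(1,3,4) by (simp add: mult_ac)
    also have "\<dots> = (-1) ^ r * E * (1 - x ^ 3) * (wp_ratio q 0 r * (1 + x))"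
      by algebra
    also have "\<dots> = (-1) ^ r * E * (1 - x ^ 3)"
      by (simp only: W mult_1_right)
    finally show ?thesis unfolding pw .
  qed
  have "(\<lambda>r. beta_term q 0 r + q * alpha_term q 0 r) sums (suminf (beta_term q 0) + q * suminf (alpha_term q 0))"
    by (intro sums_add sums_mult summable_sums summable_alpha_term summable_beta_term)
  from sums_unique2[OF this[unfolded eq] theta_sums[of 5]] show ?thesis
    unfolding gg_sum_0_eq_beta_alpha by simp
qed

text \<open>Here \<open>1 - x^2 = (1 + x) (1 - x)\<close> does the cancellation.\<close>

lemma gg_theta_1:
  "qpoch_inf (q ^ 2) (q ^ 2) * suminf (gg_term q 1) =
     qpoch_inf (q ^ 7) (q ^ 8) * qpoch_inf q (q ^ 8) * qpoch_inf (q ^ 8) (q ^ 8)"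
proof -
  have eq: "alpha_term q 0 r =
     (-1) ^ r * q ^ (8 * (r choose 2) + 7 * r) * (1 - q ^ ((16 - 2 * 7) * r + (8 - 7)))" for r
  proof -
    define x where "x = q ^ (2 * r + 1)"
    define E where "E = q ^ (4 * r ^ 2 + 3 * r)"
    have W: "wp_ratio q 0 r * (1 + x) = 1"
      using qpoch_bases_neq_0 qpoch_factors_neq_0(1)[of r]
      by (simp add: wp_ratio_def x_def qpoch_steps(1)[of r, simplified])
    have pw: "q ^ (4 * r ^ 2 + 3 * r + 4 * r * 0) = E" "q ^ (2 * 0 + 4 * r + 2) = x ^ 2"
       "q ^ (8 * (r choose 2) + 7 * r) = E" "q ^ ((16 - 2 * 7) * r + (8 - 7)) = x"
      unfolding E_def x_def power_mult[symmetric] power_add[symmetric] eight_choose_two[symmetric]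
      by (rule arg_cong[where f = "\<lambda>n. q ^ n"], simp)+
    have "(-1) ^ r * E * (1 - x ^ 2) * wp_ratio q 0 r = (-1) ^ r * E * (1 - x) * (wp_ratio q 0 r * (1 + x))"
      by algebra
    then show ?thesis
      unfolding alpha_term_def pw by (simp only: W mult_1_right)
  qed
  have "alpha_term q 0 sums suminf (alpha_term q 0)"
    by (intro summable_sums summable_alpha_term)
  from sums_unique2[OF this theta_sums[of 7, folded eq]] show ?thesis
    using alpha_sum_eq_gg_sum[of 0] by simp
qed

end

section \<open>The five product formulas\<close>

text \<open>For \<open>b = c = 2 s\<close> the factor left by the sum over \<open>k\<close> is
  \<open>(-q^(2j+2s+1);q^2)\<^sub>\<infinity> = (-q;q^2)\<^sub>\<infinity> / (-q;q^2)\<^sub>j\<^sub>+\<^sub>s\<close>.\<close>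

lemma qsummand_has_sum_gg:
  fixes q :: complex
  assumes q: "0 < norm q" "norm q < 1"
  shows "(qsummand q (int (2 * s)) (int (2 * s)) has_sum
     qpoch_inf (- q) q * (qpoch_inf (- q) (q ^ 2) * suminf (gg_term q s))) UNIV"
proof -
  have "(gg_term q s has_sum suminf (gg_term q s)) UNIV"
    by (intro norm_summable_imp_has_sum summable_sums summable_gg_term q)
  from has_sum_cmult_right[OF this, of "qpoch_inf (- q) (q ^ 2)"]
  have "((\<lambda>j. qpoch_inf (- q) (q ^ 2) * gg_term q s j) has_sum
     qpoch_inf (- q) (q ^ 2) * suminf (gg_term q s)) UNIV" .
  also have "(\<lambda>j. qpoch_inf (- q) (q ^ 2) * gg_term q s j) =
    (\<lambda>j. (q ^ 4) ^ (j choose 2) * (q ^ (2 * s + 2)) ^ j / qpoch (q ^ 2) (q ^ 2) j *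
       qpoch_inf (- (q ^ (2 * j + 2 * s + 1))) (q ^ 2))"
  proof
    fix j
    have e: "- q * (q ^ 2) ^ (j + s) = - (q ^ (2 * j + 2 * s + 1))"
      by (simp add: power_mult[symmetric] algebra_simps)
    have "4 * (j choose 2) + 2 * j = 2 * j ^ 2"
      using eight_choose_two[of j] by simp
    then have "2 * j ^ 2 + 2 * s * j = 4 * (j choose 2) + (2 * s + 2) * j"
      by (simp add: algebra_simps)
    then have "q ^ (2 * j ^ 2 + 2 * s * j) = (q ^ 4) ^ (j choose 2) * (q ^ (2 * s + 2)) ^ j"
      by (simp only: power_add power_mult)
    then show "qpoch_inf (- q) (q ^ 2) * gg_term q s j =
      (q ^ 4) ^ (j choose 2) * (q ^ (2 * s + 2)) ^ j / qpoch (q ^ 2) (q ^ 2) j *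
       qpoch_inf (- (q ^ (2 * j + 2 * s + 1))) (q ^ 2)"
      unfolding qpoch_inf_unfold[OF norm_q_square_less_1[OF q], of "- q" "j + s", unfolded e] gg_term_def
      using qpoch_bases_neq_0(1)[OF q, of "j + s"] by simp
  qed
  finally show ?thesis
    using qsummand_has_sum[OF q, of "2 * s + 2" "2 * s"] by simp
qed

lemma qpoch_inf_power_neq_0:
  fixes q :: complex
  assumes "0 < norm q" "norm q < 1" "0 < m" "0 < n"
  shows "qpoch_inf (q ^ m) (q ^ n) \<noteq> 0"
  using assms by (intro qpoch_inf_neq_0) (auto simp: norm_power power_less_one_iff)

lemma qpoch_inf_neg_eq:
  fixes q :: complex
  assumes "0 < norm q" "norm q < 1" "0 < n"
  shows "qpoch_inf (- (q ^ n)) (q ^ n) = qpoch_inf (q ^ (2 * n)) (q ^ (2 * n)) / qpoch_inf (q ^ n) (q ^ n)"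
proof -
  have "norm (q ^ n) < 1"
    using assms by (simp add: norm_power power_less_one_iff)
  from qpoch_inf_neg_mult[OF this, of "q ^ n"] qpoch_inf_power_neq_0[OF assms(1,2) assms(3) assms(3)]
  show ?thesis by (simp add: power_mult[symmetric] mult.commute field_simps)
qed

text \<open>The residues \<open>1, 3, 5, 7\<close> modulo 8 make up \<open>(q;q^2)\<^sub>\<infinity>\<close>, and the residues \<open>4, 8\<close> make up
  \<open>(q^4;q^4)\<^sub>\<infinity>\<close>. With \<open>(-q;q^2)\<^sub>\<infinity> (q;q^2)\<^sub>\<infinity> = (q^2;q^4)\<^sub>\<infinity>\<close> everything collapses. The formula converts
  the triple products of \<open>gg_theta_0\<close> and \<open>gg_theta_1\<close> into the reciprocal products over the
  complementary residues.\<close>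

lemma gg_product_complement:
  fixes q :: complex
  assumes q: "0 < norm q" "norm q < 1"
  shows "qpoch_inf (- q) (q ^ 2) *
      (qpoch_inf q (q ^ 8) * qpoch_inf (q ^ 3) (q ^ 8) * qpoch_inf (q ^ 5) (q ^ 8) * qpoch_inf (q ^ 7) (q ^ 8) *
       qpoch_inf (q ^ 4) (q ^ 8) * qpoch_inf (q ^ 8) (q ^ 8)) = qpoch_inf (q ^ 2) (q ^ 2)"
proof -
  have lt: "norm (q ^ 2) < 1" "norm (q ^ 4) < 1"
    using q by (auto simp: norm_power power_less_one_iff)
  have "qpoch_inf q (q ^ 2) = qpoch_inf q (q ^ 4) * qpoch_inf (q ^ 3) (q ^ 4)"
    using qpoch_inf_bisect[OF lt(1), of q] by (simp add: power_mult[symmetric] power_Suc[symmetric] del: power_Suc)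
  moreover have "qpoch_inf q (q ^ 4) = qpoch_inf q (q ^ 8) * qpoch_inf (q ^ 5) (q ^ 8)"
    using qpoch_inf_bisect[OF lt(2), of q] by (simp add: power_mult[symmetric] power_Suc[symmetric] del: power_Suc)
  moreover have "qpoch_inf (q ^ 3) (q ^ 4) = qpoch_inf (q ^ 3) (q ^ 8) * qpoch_inf (q ^ 7) (q ^ 8)"
    using qpoch_inf_bisect[OF lt(2), of "q ^ 3"] by (simp add: power_mult[symmetric] power_add[symmetric])
  moreover have "qpoch_inf (q ^ 4) (q ^ 4) = qpoch_inf (q ^ 4) (q ^ 8) * qpoch_inf (q ^ 8) (q ^ 8)"
    using qpoch_inf_bisect[OF lt(2), of "q ^ 4"] by (simp add: power_mult[symmetric] power_add[symmetric])
  moreover have "qpoch_inf (- q) (q ^ 2) * qpoch_inf q (q ^ 2) = qpoch_inf (q ^ 2) (q ^ 4)"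
    using qpoch_inf_neg_mult[OF lt(1), of q] by (simp add: power_mult[symmetric])
  moreover have "qpoch_inf (q ^ 2) (q ^ 2) = qpoch_inf (q ^ 2) (q ^ 4) * qpoch_inf (q ^ 4) (q ^ 4)"
    using qpoch_inf_bisect[OF lt(1), of "q ^ 2"] by (simp add: power_mult[symmetric] power_add[symmetric])
  ultimately show ?thesis by (simp add: mult_ac)
qed

theorem theorem3p10:
  fixes q :: complex
  assumes "0 < norm q" and "norm q < 1"
  shows "(qsummand q (-2) 1 has_sum
            2 * (qpoch_inf (q ^ 8) (q ^ 8) / qpoch_inf q q)) UNIV
    \<and> (qsummand q 0 0 has_sum
            qpoch_inf (-q) q / qpoch_inf_list [q, q ^ 4, q ^ 7] (q ^ 8)) UNIV
    \<and> (qsummand q 0 1 has_sum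
            qpoch_inf (q ^ 4) (q ^ 4) ^ 3
              / (qpoch_inf q q * qpoch_inf (q ^ 2) (q ^ 2) * qpoch_inf (q ^ 8) (q ^ 8))) UNIV
    \<and> (qsummand q 2 1 has_sum
            qpoch_inf (q ^ 8) (q ^ 8) / qpoch_inf q q) UNIV
    \<and> (qsummand q 2 2 has_sum
            qpoch_inf (-q) q / qpoch_inf_list [q ^ 3, q ^ 4, q ^ 5] (q ^ 8)) UNIV"
proof -
  note q = assms
  have lt4: "norm (q ^ 4) < 1" and lt2: "norm (q ^ 2) < 1"
    using q by (auto simp: norm_power power_less_one_iff)
  note nonzero = qpoch_inf_power_neq_0[OF q]
  have nz: "qpoch_inf (q ^ m) (q ^ m) \<noteq> 0" if "m > 0" for m
    using nonzero that by simp
  have neg1: "qpoch_inf (- q) q = qpoch_inf (q ^ 2) (q ^ 2) / qpoch_inf q q"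
    using qpoch_inf_neg_eq[OF q, of 1] by simp
  have neg2: "qpoch_inf (- (q ^ 2)) (q ^ 2) = qpoch_inf (q ^ 4) (q ^ 4) / qpoch_inf (q ^ 2) (q ^ 2)"
    using qpoch_inf_neg_eq[OF q, of 2] by simp
  have neg4: "qpoch_inf (- (q ^ 4)) (q ^ 4) = qpoch_inf (q ^ 8) (q ^ 8) / qpoch_inf (q ^ 4) (q ^ 4)"
    using qpoch_inf_neg_eq[OF q, of 4] by simp
  have nz1: "qpoch_inf q q \<noteq> 0"
    using nz[of 1] by simp

  (* The factor 2 is the first factor 1 + 1 of the product with parameter -1. *)
  have "qpoch_inf (- 1) (q ^ 4) = 2 * qpoch_inf (- (q ^ 4)) (q ^ 4)"
    using qpoch_inf_unfold[OF lt4, of "- 1" 1] by (simp add: qpoch_Suc)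
  then have id1: "(qsummand q (-2) 1 has_sum 2 * (qpoch_inf (q ^ 8) (q ^ 8) / qpoch_inf q q)) UNIV"
    using qsummand_has_sum_lebesgue[OF q, of 0] nz[of 2] nz[of 4] by (simp add: neg1 neg2 neg4)

  (* The product over exponents 2 modulo 4 is the product over even exponents without the multiples of 4. *)
  have "qpoch_inf (- (q ^ 2)) (q ^ 2) = qpoch_inf (- (q ^ 2)) (q ^ 4) * qpoch_inf (- (q ^ 4)) (q ^ 4)"
    using qpoch_inf_bisect[OF lt2, of "- (q ^ 2)"] by (simp add: power_mult[symmetric] power_add[symmetric])
  note bisected = this[unfolded neg2 neg4]
  have half: "qpoch_inf (- (q ^ 2)) (q ^ 4) =
      qpoch_inf (q ^ 4) (q ^ 4) ^ 2 / (qpoch_inf (q ^ 2) (q ^ 2) * qpoch_inf (q ^ 8) (q ^ 8))"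
    using bisected nz[of 2] nz[of 4] nz[of 8] by (simp add: field_simps power2_eq_square)
  have "qpoch_inf (- q) q * (qpoch_inf (- (q ^ 2)) (q ^ 2) * qpoch_inf (- (q ^ 2)) (q ^ 4)) =
      qpoch_inf (q ^ 4) (q ^ 4) ^ 3
              / (qpoch_inf q q * qpoch_inf (q ^ 2) (q ^ 2) * qpoch_inf (q ^ 8) (q ^ 8))"
    unfolding half neg1 neg2 using nz[of 2] nz[of 4] nz[of 8] nz1
    by (simp add: power2_eq_square power3_eq_cube mult.assoc)
  then have id3: "(qsummand q 0 1 has_sum qpoch_inf (q ^ 4) (q ^ 4) ^ 3
              / (qpoch_inf q q * qpoch_inf (q ^ 2) (q ^ 2) * qpoch_inf (q ^ 8) (q ^ 8))) UNIV"
    using qsummand_has_sum_lebesgue[OF q, of 2] by simp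

  have id4: "(qsummand q 2 1 has_sum qpoch_inf (q ^ 8) (q ^ 8) / qpoch_inf q q) UNIV"
    using qsummand_has_sum_lebesgue[OF q, of 4] nz[of 2] nz[of 4] by (simp add: neg1 neg2 neg4)

  have nz8: "qpoch_inf (q ^ m) (q ^ 8) \<noteq> 0" if "m > 0" for m
    using nonzero that by simp
  note prod = gg_product_complement[OF q]
  have "qpoch_inf (- q) (q ^ 2) * suminf (gg_term q 0) =
      1 / (qpoch_inf q (q ^ 8) * qpoch_inf (q ^ 4) (q ^ 8) * qpoch_inf (q ^ 7) (q ^ 8))"
  proof -
    have "qpoch_inf (q ^ 2) (q ^ 2) * (qpoch_inf (- q) (q ^ 2) * suminf (gg_term q 0) *
       (qpoch_inf q (q ^ 8) * qpoch_inf (q ^ 4) (q ^ 8) * qpoch_inf (q ^ 7) (q ^ 8))) = qpoch_inf (q ^ 2) (q ^ 2)"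
      using gg_theta_0[OF q] prod by algebra
    then show ?thesis
      using nz[of 2] nz8[of 1] nz8[of 4] nz8[of 7] by (simp add: field_simps)
  qed
  then have id2: "(qsummand q 0 0 has_sum qpoch_inf (-q) q / qpoch_inf_list [q, q ^ 4, q ^ 7] (q ^ 8)) UNIV"
    using qsummand_has_sum_gg[OF q, of 0] by (simp add: qpoch_inf_list_def mult.assoc)

  have "qpoch_inf (- q) (q ^ 2) * suminf (gg_term q 1) =
      1 / (qpoch_inf (q ^ 3) (q ^ 8) * qpoch_inf (q ^ 4) (q ^ 8) * qpoch_inf (q ^ 5) (q ^ 8))"
  proof -
    have "qpoch_inf (q ^ 2) (q ^ 2) * (qpoch_inf (- q) (q ^ 2) * suminf (gg_term q 1) *
       (qpoch_inf (q ^ 3) (q ^ 8) * qpoch_inf (q ^ 4) (q ^ 8) * qpoch_inf (q ^ 5) (q ^ 8))) = qpoch_inf (q ^ 2) (q ^ 2)"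
      using gg_theta_1[OF q] prod by algebra
    then show ?thesis
      using nz[of 2] nz8[of 3] nz8[of 4] nz8[of 5] by (simp add: field_simps)
  qed
  then have id5: "(qsummand q 2 2 has_sum qpoch_inf (-q) q / qpoch_inf_list [q ^ 3, q ^ 4, q ^ 5] (q ^ 8)) UNIV"
    using qsummand_has_sum_gg[OF q, of 1] by (simp add: qpoch_inf_list_def mult.assoc)
  show ?thesis
    by (intro conjI id1 id2 id3 id4 id5)
qed

end
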